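(* Fix $i,j\in\{1,\dots,k\}$ and let the trimming proportions satisfy $0\le a_i\le a_j<\overline{b}_i\le\overline{b}_j\le1$, where $\overline{b}_r=1-b_r$. Let $$\sigma_{ij}^2=\Gamma\int_{a_i}^{\overline{b}_i}\int_{a_j}^{\overline{b}_j}K(v,w)\,H_j'(v)\,H_i'(w)\,dv\,dw,\qquad \Gamma=\frac{1}{(1-a_i-b_i)(1-a_j-b_j)}.$$ Then $\sigma_{ij}^2=\Gamma V_{11}$, where $$\begin{aligned} V_{11}={}& I_i(a_i,a_j)\,\overline{I}_j(a_j,\overline{b}_j)+b_jH_j(\overline{b}_j)\,I_i(a_j,\overline{b}_i)-a_jH_j(a_j)\,\overline{I}_i(a_j,\overline{b}_i)\\ &-b_iH_i(\overline{b}_i)\int_{a_j}^{\overline{b}_i}H_j(v)\,dv+\int_{a_j}^{\overline{b}_i}H_i(v)H_j(v)\,dv\\ &-a_jH_i(a_j)\int_{a_j}^{\overline{b}_i}H_j(v)\,dv-\int_{a_j}^{\overline{b}_i}\int_v^{\overline{b}_i}H_i(w)H_j(v)\,dw\,dv-\int_{a_j}^{\overline{b}_i}\int_{a_j}^{v}H_i(w)H_j(v)\,dw\,dv\\ &+\overline{b}_iH_i(\overline{b}_i)\int_{\overline{b}_i}^{\overline{b}_j}H_j(v)\,dv-a_jH_i(a_j)\int_{\overline{b}_i}^{\overline{b}_j}H_j(v)\,dv-\int_{a_j}^{\overline{b}_i}\int_{\overline{b}_i}^{\overline{b}_j}H_i(w)H_j(v)\,dv\,dw. \end{aligned}$$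
   Context: $F$ is a cumulative distribution function on the real line, with quantile function $F^{-1}(u)=\inf\{x:F(x)\ge u\}$. The $h_r$ are given real functions, and $H_r:=h_r\circ F^{-1}$. For $u\in[0,1]$, $\overline{u}:=1-u$. The kernel is $K(v,w)=\min\{v,w\}-vw$ for $0\le v,w\le1$. $H_r'$ is the derivative of $H_r$, with $H_r'(u)\,du=dh_r(F^{-1}(u))$. For $r\in\{i,j\}$, $H_r$ is taken to be finite and absolutely continuous on $[a_r,\overline{b}_r]$, so that integration by parts is valid. For $a\le b$ in $[a_r,\overline{b}_r]$, $$I_r(a,b)=\int_a^b vH_r'(v)\,dv=bH_r(b)-aH_r(a)-\int_a^bH_r(v)\,dv,$$ $$\overline{I}_r(a,b)=\int_a^b(1-v)H_r'(v)\,dv=(1-b)H_r(b)-(1-a)H_r(a)+\int_a^bH_r(v)\,dv.$$ *)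

theory Defs
  imports "HOL-Probability.Distribution_Functions"
begin

definition is_cdf :: "(real \<Rightarrow> real) \<Rightarrow> bool" where
  "is_cdf F \<longleftrightarrow> (\<exists>M. real_distribution M \<and> F = cdf M)"

(* The infimum is taken in the extended reals: it is -\<infinity> at u = 0, and it may be \<infinity> at u = 1. *)
definition quantile :: "(real \<Rightarrow> real) \<Rightarrow> real \<Rightarrow> ereal" where
  "quantile F u = Inf {ereal x | x. F x \<ge> u}"

(* H = h o quantile F wherever the quantile is a real number, hence for all 0 < u < 1 when F is
   a distribution function.  At an endpoint u = 0 or u = 1 with infinite quantile, the value is
   the one-sided limit from inside (0,1).  If that limit does not exist the value is arbitrary,
   and then H is not continuous at that endpoint. *)
definition Hfun :: "(real \<Rightarrow> real) \<Rightarrow> (real \<Rightarrow> real) \<Rightarrow> real \<Rightarrow> real" where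
  "Hfun F h u =
     (if \<bar>quantile F u\<bar> \<noteq> \<infinity> then h (real_of_ereal (quantile F u))
      else Lim (at u within {0<..<1}) (\<lambda>v. h (real_of_ereal (quantile F v))))"

definition abs_cont_on :: "real \<Rightarrow> real \<Rightarrow> (real \<Rightarrow> real) \<Rightarrow> bool" where
  "abs_cont_on a b f \<longleftrightarrow>
     (\<forall>\<epsilon>>0. \<exists>\<delta>>0. \<forall>(n::nat) s t.
        (\<forall>m<n. a \<le> s m \<and> s m \<le> t m \<and> t m \<le> b) \<and>
        disjoint_family_on (\<lambda>m. {s m<..<t m}) {..<n} \<and>
        (\<Sum>m<n. t m - s m) < \<delta>
        \<longrightarrow> (\<Sum>m<n. \<bar>f (t m) - f (s m)\<bar>) < \<epsilon>)"

definition Kker :: "real \<Rightarrow> real \<Rightarrow> real" where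
  "Kker v w = min v w - v * w"

(* Below, deriv H is an arbitrary value where H is not differentiable; for H absolutely
   continuous on the interval of integration this is a null set. *)

definition Iint :: "(real \<Rightarrow> real) \<Rightarrow> real \<Rightarrow> real \<Rightarrow> real" where
  "Iint H a b = (LINT v:{a..b}|lebesgue. v * deriv H v)"

definition Ibar :: "(real \<Rightarrow> real) \<Rightarrow> real \<Rightarrow> real \<Rightarrow> real" where
  "Ibar H a b = (LINT v:{a..b}|lebesgue. (1 - v) * deriv H v)"

definition Gam :: "(nat \<Rightarrow> real) \<Rightarrow> (nat \<Rightarrow> real) \<Rightarrow> nat \<Rightarrow> nat \<Rightarrow> real" where
  "Gam a b i j = 1 / ((1 - a i - b i) * (1 - a j - b j))"

definition sigma2 ::
  "(nat \<Rightarrow> real \<Rightarrow> real) \<Rightarrow> (nat \<Rightarrow> real) \<Rightarrow> (nat \<Rightarrow> real) \<Rightarrow> nat \<Rightarrow> nat \<Rightarrow> real" where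
  "sigma2 H a b i j =
     Gam a b i j *
     (LINT w:{a i..1 - b i}|lebesgue.
        (LINT v:{a j..1 - b j}|lebesgue. Kker v w * deriv (H j) v * deriv (H i) w))"

definition V11 ::
  "(nat \<Rightarrow> real \<Rightarrow> real) \<Rightarrow> (nat \<Rightarrow> real) \<Rightarrow> (nat \<Rightarrow> real) \<Rightarrow> nat \<Rightarrow> nat \<Rightarrow> real" where
  "V11 H a b i j =
       Iint (H i) (a i) (a j) * Ibar (H j) (a j) (1 - b j)
     + b j * H j (1 - b j) * Iint (H i) (a j) (1 - b i)
     - a j * H j (a j) * Ibar (H i) (a j) (1 - b i)
     - b i * H i (1 - b i) * (LINT v:{a j..1 - b i}|lebesgue. H j v)
     + (LINT v:{a j..1 - b i}|lebesgue. H i v * H j v)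
     - a j * H i (a j) * (LINT v:{a j..1 - b i}|lebesgue. H j v)
     - (LINT v:{a j..1 - b i}|lebesgue. (LINT w:{v..1 - b i}|lebesgue. H i w * H j v))
     - (LINT v:{a j..1 - b i}|lebesgue. (LINT w:{a j..v}|lebesgue. H i w * H j v))
     + (1 - b i) * H i (1 - b i) * (LINT v:{1 - b i..1 - b j}|lebesgue. H j v)
     - a j * H i (a j) * (LINT v:{1 - b i..1 - b j}|lebesgue. H j v)
     - (LINT w:{a j..1 - b i}|lebesgue. (LINT v:{1 - b i..1 - b j}|lebesgue. H i w * H j v))"

end

theory Submission
  imports Defs
begin

text \<open>
The substance is the fundamental theorem of calculus for absolutely continuous functions.
Differentiability almost everywhere is a Vitali covering argument that needs no monotonicity:
if the slopes of \<open>f\<close> over small intervals around the points of \<open>E\<close> are repeatedly below \<open>\<alpha>\<close> and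
repeatedly above \<open>\<beta> > \<alpha>\<close>, cover \<open>E\<close> up to \<open>\<epsilon>\<close> by disjoint intervals of slope below \<open>\<alpha>\<close>, and refine
them by disjoint intervals of slope above \<open>\<beta>\<close>. The gaps have total length at most \<open>3\<epsilon>\<close>, so by absolute
continuity both families carry nearly the same total increment of \<open>f\<close>, which forces \<open>E\<close> to be null.
In the Riemann sums for \<open>f'\<close>, the tags at points without derivative lie in intervals of small
total length, which again contribute little.

With integration by parts, for \<open>w\<close> between \<open>c = a\<^sub>j\<close> and \<open>q = 1 - b\<^sub>j\<close> the inner integral is
\<open>w (1 - q) g(q) - (1 - w) c g(c) + w G(q) - G(w)\<close> with \<open>g = H\<^sub>j\<close> and \<open>G(w)\<close> the integral of \<open>g\<close>
over \<open>[c, w]\<close>; one more integration by parts against \<open>H\<^sub>i'\<close> gives the formula.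
\<close>

subsection \<open>Packings of an interval\<close>

text \<open>A finite set of endpoint pairs, so that lengths and increments are plain sums over a
  set. Only the open intervals are disjoint: neighbours may share an endpoint. Degenerate pairs are
  excluded because their empty interiors would be disjoint from everything, and distinct pairs could
  then fail to be ordered.\<close>

definition packing :: "real \<Rightarrow> real \<Rightarrow> (real \<times> real) set \<Rightarrow> bool" where
  "packing a b P \<longleftrightarrow> finite P \<and> (\<forall>(s,t)\<in>P. a \<le> s \<and> s < t \<and> t \<le> b) \<and>
     disjoint_family_on (\<lambda>(s,t). {s<..<t}) P"

lemma packing_finite: "packing a b P \<Longrightarrow> finite P"
  by (simp add: packing_def)

lemma packingD:
  assumes "packing a b P" "(s,t) \<in> P"
  shows "a \<le> s" "s < t" "t \<le> b"
  using assms by (auto simp: packing_def)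

lemma packing_mono: "packing a b P \<Longrightarrow> a' \<le> a \<Longrightarrow> b \<le> b' \<Longrightarrow> packing a' b' P"
  unfolding packing_def by fastforce

text \<open>Overlapping intervals would share a point strictly between the larger left end and the
  smaller right end. This order form of disjointness, with \<open>packingI\<close> as its converse,
  replaces set intersections in the later interval combinatorics.\<close>

lemma packing_ordered:
  assumes P: "packing a b P" "(s,t) \<in> P" "(s',t') \<in> P" "(s,t) \<noteq> (s',t')"
  shows "t \<le> s' \<or> t' \<le> s"
proof (rule ccontr)
  assume "\<not> ?thesis"
  then have "max s s' < min t t'"
    using packingD[OF P(1,2)] packingD[OF P(1,3)] by auto
  then obtain x where "max s s' < x" "x < min t t'"
    using dense by blast
  then have "x \<in> {s<..<t} \<inter> {s'<..<t'}" by auto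
  moreover have "{s<..<t} \<inter> {s'<..<t'} = {}"
    using P unfolding packing_def disjoint_family_on_def by fastforce
  ultimately show False by auto
qed

lemma packingI:
  assumes "finite P" "\<And>s t. (s,t) \<in> P \<Longrightarrow> a \<le> s \<and> s < t \<and> t \<le> b"
    and "\<And>s t s' t'. (s,t) \<in> P \<Longrightarrow> (s',t') \<in> P \<Longrightarrow> (s,t) \<noteq> (s',t') \<Longrightarrow> t \<le> s' \<or> t' \<le> s"
  shows "packing a b P"
  unfolding packing_def disjoint_family_on_def
proof (intro conjI ballI impI)
  fix p q assume pq: "p \<in> P" "q \<in> P" "p \<noteq> q"
  obtain s t s' t' where "p = (s,t)" "q = (s',t')" by fastforce
  with pq assms(3)[of s t s' t'] show "(case p of (s,t) \<Rightarrow> {s<..<t}) \<inter> (case q of (s,t) \<Rightarrow> {s<..<t}) = {}"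
    by auto
qed (use assms in auto)

lemma packing_Un:
  assumes "packing a c P" "packing c' b Q" "a \<le> c" "c \<le> c'" "c' \<le> b"
  shows "packing a b (P \<union> Q)"
proof (rule packingI)
  show "finite (P \<union> Q)" using assms packing_finite by blast
  show "a \<le> s \<and> s < t \<and> t \<le> b" if "(s,t) \<in> P \<union> Q" for s t
    using that packingD[OF assms(1), of s t] packingD[OF assms(2), of s t] assms(3-) by force
  show "t \<le> s' \<or> t' \<le> s" if "(s,t) \<in> P \<union> Q" "(s',t') \<in> P \<union> Q" "(s,t) \<noteq> (s',t')" for s t s' t'
    using that packingD[OF assms(1), of s t] packingD[OF assms(2), of s t]
     packingD[OF assms(1), of s' t'] packingD[OF assms(2), of s' t'] assms(3-)
     packing_ordered[OF assms(1), of s t s' t'] packing_ordered[OF assms(2), of s t s' t']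
    by force
qed

text \<open>Enumerating the finite set of pairs turns a packing into the indexed family in the
  definition of \<open>abs_cont_on\<close>; the covering and Riemann sum arguments use this
  form.\<close>

lemma abs_cont_on_packing:
  assumes "abs_cont_on a b f" "\<epsilon> > 0"
  obtains \<delta> where "\<delta> > 0"
    "\<And>P. packing a b P \<Longrightarrow> (\<Sum>(s,t)\<in>P. t - s) < \<delta> \<Longrightarrow> (\<Sum>(s,t)\<in>P. \<bar>f t - f s\<bar>) < \<epsilon>"
proof -
  obtain \<delta> where d: "\<delta> > 0" "\<And>(n::nat) s t. (\<forall>m<n. a \<le> s m \<and> s m \<le> t m \<and> t m \<le> b) \<Longrightarrow>
        disjoint_family_on (\<lambda>m. {s m<..<t m}) {..<n} \<Longrightarrow>
        (\<Sum>m<n. t m - s m) < \<delta> \<Longrightarrow> (\<Sum>m<n. \<bar>f (t m) - f (s m)\<bar>) < \<epsilon>"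
    using assms unfolding abs_cont_on_def by meson
  show thesis
  proof (rule that[OF d(1)])
    fix P assume P: "packing a b P" and len: "(\<Sum>(s,t)\<in>P. t - s) < \<delta>"
    obtain \<pi> where \<pi>: "bij_betw \<pi> {..<card P} P"
      using packing_finite[OF P] by (metis atLeast0LessThan ex_bij_betw_nat_finite)
    define s where "s m = fst (\<pi> m)" for m
    define t where "t m = snd (\<pi> m)" for m
    have \<pi>_st: "\<pi> m = (s m, t m)" for m by (simp add: s_def t_def)
    have inP: "(s m, t m) \<in> P" if "m < card P" for m
      using \<pi> that unfolding \<pi>_st[symmetric] by (auto simp: bij_betw_def)
    have re: "(\<Sum>(s,t)\<in>P. g s t) = (\<Sum>m<card P. g (s m) (t m))" for g :: "real \<Rightarrow> real \<Rightarrow> real"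
      using sum.reindex_bij_betw[OF \<pi>, of "\<lambda>(s,t). g s t"] by (simp add: \<pi>_st)
    show "(\<Sum>(s,t)\<in>P. \<bar>f t - f s\<bar>) < \<epsilon>"
      unfolding re
    proof (rule d(2))
      show "\<forall>m<card P. a \<le> s m \<and> s m \<le> t m \<and> t m \<le> b"
        using packingD[OF P inP] by force
      show "disjoint_family_on (\<lambda>m. {s m<..<t m}) {..<card P}"
        unfolding disjoint_family_on_def
      proof (intro ballI impI)
        fix m n assume "m \<in> {..<card P}" "n \<in> {..<card P}" "m \<noteq> n"
        then have "(s m, t m) \<noteq> (s n, t n)"
          using \<pi> unfolding \<pi>_st[symmetric] bij_betw_def inj_on_def by blast
        then have "t m \<le> s n \<or> t n \<le> s m"
          using packing_ordered[OF P inP inP] \<open>m \<in> _\<close> \<open>n \<in> _\<close> by auto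
        then show "{s m<..<t m} \<inter> {s n<..<t n} = {}" by auto
      qed
      show "(\<Sum>m<card P. t m - s m) < \<delta>" using len unfolding re .
    qed
  qed
qed

text \<open>One interval of \<open>P\<close> separates the others into those to its left and those
  to its right; the induction fills both sides. The gap family \<open>Q\<close> is chosen before
  \<open>g\<close>, so a single \<open>Q\<close> serves for lengths (\<open>g\<close> the identity)
  and for increments of \<open>f\<close>.\<close>

lemma packing_gaps:
  assumes "packing c d P" "c \<le> d"
  shows "\<exists>Q. packing c d Q \<and>
    (\<forall>g::real \<Rightarrow> real. (\<Sum>(s,t)\<in>P. g t - g s) + (\<Sum>(s,t)\<in>Q. g t - g s) = g d - g c)"
  using assms
proof (induction "card P" arbitrary: c d P rule: less_induct)
  case less
  show ?case
  proof (cases "P = {}")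
    case True
    show ?thesis
    proof (cases "c < d")
      case True
      then have "packing c d {(c,d)}" by (auto intro!: packingI)
      then show ?thesis using \<open>P = {}\<close> by (intro exI[of _ "{(c,d)}"]) auto
    next
      case False
      then show ?thesis using \<open>P = {}\<close> less.prems
        by (intro exI[of _ "{}"]) (auto intro!: packingI)
    qed
  next
    case False
    then obtain s t where st: "(s,t) \<in> P" by fast
    note b = packingD[OF less.prems(1) st]
    have fin: "finite P" using less.prems packing_finite by blast
    define P1 where "P1 = {p \<in> P. snd p \<le> s}"
    define P2 where "P2 = {p \<in> P. t \<le> fst p}"
    have P: "P = insert (s,t) (P1 \<union> P2)"
    proof
      show "P \<subseteq> insert (s,t) (P1 \<union> P2)"
      proof (clarsimp simp: P1_def P2_def)
        fix s' t' assume "(s',t') \<in> P" "s' = s \<longrightarrow> t' \<noteq> t" "\<not> t \<le> s'"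
        then show "t' \<le> s" using packing_ordered[OF less.prems(1) st, of s' t'] by auto
      qed
    qed (auto simp: P1_def P2_def st)
    have lt: "fst p < snd p" if "p \<in> P" for p
      using packingD(2)[OF less.prems(1), of "fst p" "snd p"] that by simp
    have n1: "(s,t) \<notin> P1 \<union> P2" and n2: "P1 \<inter> P2 = {}"
      using b lt by (force simp: P1_def P2_def)+
    have f12: "finite P1" "finite P2" using fin by (auto simp: P1_def P2_def)
    have "P1 \<subset> P" "P2 \<subset> P"
      using n1 st P by blast+
    then have "card P1 < card P" "card P2 < card P"
      using psubset_card_mono[OF fin] by blast+
    moreover have "packing c s P1" "packing t d P2"
      unfolding P1_def P2_def using less.prems(1)
      by (auto intro!: packingI simp: fin dest: packingD packing_ordered[OF less.prems(1)])
    ultimately obtain Q1 Q2 where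
      Q1: "packing c s Q1" "\<And>g::real\<Rightarrow>real. (\<Sum>(s,t)\<in>P1. g t - g s) + (\<Sum>(s,t)\<in>Q1. g t - g s) = g s - g c" and
      Q2: "packing t d Q2" "\<And>g::real\<Rightarrow>real. (\<Sum>(s,t)\<in>P2. g t - g s) + (\<Sum>(s,t)\<in>Q2. g t - g s) = g d - g t"
      using less.hyps[of P1 c s] less.hyps[of P2 t d] b by metis
    have nQ: "Q1 \<inter> Q2 = {}"
    proof -
      have False if "(x,y) \<in> Q1" "(x,y) \<in> Q2" for x y
        using packingD[OF Q1(1) that(1)] packingD[OF Q2(1) that(2)] b by linarith
      then show ?thesis by auto
    qed
    show ?thesis
    proof (intro exI conjI allI)
      show "packing c d (Q1 \<union> Q2)" using packing_Un[OF Q1(1) Q2(1)] b by auto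
      fix g :: "real \<Rightarrow> real"
      have "(\<Sum>(s,t)\<in>P. g t - g s) = (g t - g s) + ((\<Sum>(s,t)\<in>P1. g t - g s) + (\<Sum>(s,t)\<in>P2. g t - g s))"
        unfolding P using n1 n2 f12 by (simp add: sum.union_disjoint)
      moreover have "(\<Sum>(s,t)\<in>Q1 \<union> Q2. g t - g s) = (\<Sum>(s,t)\<in>Q1. g t - g s) + (\<Sum>(s,t)\<in>Q2. g t - g s)"
        using nQ Q1(1) Q2(1) by (simp add: sum.union_disjoint packing_finite)
      ultimately show "(\<Sum>(s,t)\<in>P. g t - g s) + (\<Sum>(s,t)\<in>Q1 \<union> Q2. g t - g s) = g d - g c"
        using Q1(2)[of g] Q2(2)[of g] by linarith
    qed
  qed
qed

text \<open>Converts indexed intervals, some possibly degenerate, into a packing: clamped intervals,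
  tagged divisions and divisions all arise in this form. Degenerate members are dropped, which is
  harmless as \<open>G x x = 0\<close>.\<close>

lemma packing_image:
  fixes lo hi :: "'i \<Rightarrow> real"
  assumes fin: "finite I" and bd: "\<And>i. i \<in> I \<Longrightarrow> a \<le> lo i \<and> lo i \<le> hi i \<and> hi i \<le> b"
    and disj: "\<And>i j. i \<in> I \<Longrightarrow> j \<in> I \<Longrightarrow> i \<noteq> j \<Longrightarrow> {lo i<..<hi i} \<inter> {lo j<..<hi j} = {}"
  obtains P where "packing a b P" "P \<subseteq> (\<lambda>i. (lo i, hi i)) ` I"
    "\<And>G :: real \<Rightarrow> real \<Rightarrow> real. (\<And>x. G x x = 0) \<Longrightarrow> (\<Sum>i\<in>I. G (lo i) (hi i)) = (\<Sum>(s,t)\<in>P. G s t)"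
proof -
  define J where "J = {i\<in>I. lo i < hi i}"
  define h where "h i = (lo i, hi i)" for i
  have J: "finite J" "J \<subseteq> I" using fin by (auto simp: J_def)
  have ord: "hi i \<le> lo j \<or> hi j \<le> lo i" if "i \<in> J" "j \<in> J" "i \<noteq> j" for i j
  proof (rule ccontr)
    assume "\<not> ?thesis"
    then have "max (lo i) (lo j) < min (hi i) (hi j)" using that by (auto simp: J_def)
    then obtain x where "max (lo i) (lo j) < x" "x < min (hi i) (hi j)" using dense by blast
    then have "x \<in> {lo i<..<hi i} \<inter> {lo j<..<hi j}" by auto
    then show False using disj[of i j] that J by blast
  qed
  \<comment> \<open>Equal nondegenerate intervals with different indices would have intersecting
    interiors, so nothing is lost when the sum over \<open>J\<close> is reindexed by endpoint
    pairs.\<close>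
  have inj: "inj_on h J"
  proof (rule inj_onI, rule ccontr)
    fix i j assume *: "i \<in> J" "j \<in> J" "h i = h j" "i \<noteq> j"
    then show False using ord[OF *(1,2,4)] by (auto simp: h_def J_def)
  qed
  show thesis
  proof (rule that[of "h ` J"])
    show "packing a b (h ` J)"
    proof (rule packingI)
      show "a \<le> s \<and> s < t \<and> t \<le> b" if "(s,t) \<in> h ` J" for s t
        using that bd by (auto simp: h_def J_def)
      show "t \<le> s' \<or> t' \<le> s"
        if st: "(s,t) \<in> h ` J" "(s',t') \<in> h ` J" "(s,t) \<noteq> (s',t')" for s t s' t'
      proof -
        from st(1,2) obtain i j where ij: "i \<in> J" "j \<in> J" "(s,t) = h i" "(s',t') = h j" by blast
        then have "i \<noteq> j" using st(3) by auto
        then show ?thesis using ord[OF ij(1,2)] ij(3,4) by (simp add: h_def)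
      qed
    qed (use J in simp)
    show "h ` J \<subseteq> (\<lambda>i. (lo i, hi i)) ` I" using J by (auto simp: h_def)
    fix G :: "real \<Rightarrow> real \<Rightarrow> real" assume G: "\<And>x. G x x = 0"
    have "(\<Sum>i\<in>I. G (lo i) (hi i)) = (\<Sum>i\<in>J. G (lo i) (hi i))"
    proof (rule sum.mono_neutral_right[OF fin J(2)])
      show "\<forall>i\<in>I - J. G (lo i) (hi i) = 0"
      proof
        fix i assume "i \<in> I - J"
        then have "lo i = hi i" using bd[of i] by (auto simp: J_def)
        then show "G (lo i) (hi i) = 0" using G by simp
      qed
    qed
    also have "\<dots> = (\<Sum>(s,t)\<in>h ` J. G s t)"
      by (subst sum.reindex[OF inj]) (simp add: h_def)
    finally show "(\<Sum>i\<in>I. G (lo i) (hi i)) = (\<Sum>(s,t)\<in>h ` J. G s t)" .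
  qed
qed

text \<open>Apply \<open>packing_gaps\<close> inside each interval of \<open>P\<close> and collect
  the gaps; again one \<open>Q\<close> works for all \<open>g\<close>.\<close>

lemma packing_refine_gaps:
  assumes P: "packing a b P" and R: "packing a b R"
    and RP: "\<And>s t. (s,t) \<in> R \<Longrightarrow> \<exists>(c,d)\<in>P. c \<le> s \<and> t \<le> d"
  shows "\<exists>Q. packing a b Q \<and>
    (\<forall>g::real \<Rightarrow> real. (\<Sum>(s,t)\<in>R. g t - g s) + (\<Sum>(s,t)\<in>Q. g t - g s) = (\<Sum>(s,t)\<in>P. g t - g s))"
proof -
  define Rp where "Rp p = {q \<in> R. fst p \<le> fst q \<and> snd q \<le> snd p}" for p
  have "\<exists>Q. packing (fst p) (snd p) Q \<and>
    (\<forall>g::real \<Rightarrow> real. (\<Sum>(s,t)\<in>Rp p. g t - g s) + (\<Sum>(s,t)\<in>Q. g t - g s) = g (snd p) - g (fst p))"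
    if "p \<in> P" for p
  proof (rule packing_gaps)
    show "packing (fst p) (snd p) (Rp p)"
      unfolding Rp_def using packing_finite[OF R]
      by (auto intro!: packingI dest: packingD[OF R] packing_ordered[OF R])
    show "fst p \<le> snd p" using packingD(2)[OF P, of "fst p" "snd p"] that by simp
  qed
  then obtain Q where Q: "\<And>p. p \<in> P \<Longrightarrow> packing (fst p) (snd p) (Q p)"
    and Qg: "\<And>p g. p \<in> P \<Longrightarrow> (\<Sum>(s,t)\<in>Rp p. g t - g s) + (\<Sum>(s,t)\<in>Q p. g t - g s) = g (snd p) - (g (fst p)::real)"
    by metis
  have fP: "finite P" using P packing_finite by blast
  have apart: "snd p \<le> fst q \<or> snd q \<le> fst p" if "p \<in> P" "q \<in> P" "p \<noteq> q" for p q
    using packing_ordered[OF P, of "fst p" "snd p" "fst q" "snd q"] that by (simp add: prod_eq_iff)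
  have Pd: "a \<le> fst p" "snd p \<le> b" if "p \<in> P" for p
    using packingD[OF P, of "fst p" "snd p"] that by auto
  have disjR: "Rp p \<inter> Rp q = {}" if "p \<in> P" "q \<in> P" "p \<noteq> q" for p q
  proof -
    have False if "(x,y) \<in> Rp p" "(x,y) \<in> Rp q" for x y
      using that apart[OF \<open>p \<in> P\<close> \<open>q \<in> P\<close> \<open>p \<noteq> q\<close>] packingD(2)[OF R, of x y] by (auto simp: Rp_def)
    then show ?thesis by auto
  qed
  have disjQ: "Q p \<inter> Q q = {}" if "p \<in> P" "q \<in> P" "p \<noteq> q" for p q
  proof -
    have False if "(x,y) \<in> Q p" "(x,y) \<in> Q q" for x y
      using apart[OF \<open>p \<in> P\<close> \<open>q \<in> P\<close> \<open>p \<noteq> q\<close>] packingD[OF Q[OF \<open>p \<in> P\<close>] that(1)]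
       packingD[OF Q[OF \<open>q \<in> P\<close>] that(2)] by linarith
    then show ?thesis by auto
  qed
  have R_eq: "R = (\<Union>p\<in>P. Rp p)"
  proof
    show "R \<subseteq> (\<Union>p\<in>P. Rp p)"
    proof clarify
      fix s t assume "(s,t) \<in> R"
      from RP[OF this] obtain p where "p \<in> P" "fst p \<le> s" "t \<le> snd p" by fastforce
      with \<open>(s,t) \<in> R\<close> show "(s,t) \<in> (\<Union>p\<in>P. Rp p)" by (auto simp: Rp_def)
    qed
  qed (auto simp: Rp_def)
  have fin: "finite (Rp p)" for p using packing_finite[OF R] by (simp add: Rp_def)
  show ?thesis
  proof (intro exI conjI allI)
    show "packing a b (\<Union>p\<in>P. Q p)"
    proof (rule packingI)
      show "finite (\<Union>p\<in>P. Q p)" using fP packing_finite[OF Q] by blast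
      fix s t assume "(s,t) \<in> (\<Union>p\<in>P. Q p)"
      then obtain p where p: "p \<in> P" "(s,t) \<in> Q p" by blast
      show "a \<le> s \<and> s < t \<and> t \<le> b"
        using packingD[OF Q[OF p(1)] p(2)] Pd[OF p(1)] by linarith
      fix s' t' assume "(s',t') \<in> (\<Union>p\<in>P. Q p)"
      then obtain q where q: "q \<in> P" "(s',t') \<in> Q q" by blast
      assume ne: "(s,t) \<noteq> (s',t')"
      show "t \<le> s' \<or> t' \<le> s"
      proof (cases "p = q")
        case True
        then show ?thesis using packing_ordered[OF Q[OF p(1)] p(2) _ ne] q by simp
      next
        case False
        then show ?thesis using apart[OF p(1) q(1) False]
          packingD[OF Q[OF p(1)] p(2)] packingD[OF Q[OF q(1)] q(2)] by linarith
      qed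
    qed
    fix g :: "real \<Rightarrow> real"
    have "(\<Sum>(s,t)\<in>R. g t - g s) = (\<Sum>p\<in>P. \<Sum>(s,t)\<in>Rp p. g t - g s)"
      unfolding R_eq by (rule sum.UNION_disjoint) (use fP fin disjR in auto)
    moreover have "(\<Sum>(s,t)\<in>(\<Union>p\<in>P. Q p). g t - g s) = (\<Sum>p\<in>P. \<Sum>(s,t)\<in>Q p. g t - g s)"
      by (rule sum.UNION_disjoint) (use fP packing_finite[OF Q] disjQ in auto)
    ultimately have "(\<Sum>(s,t)\<in>R. g t - g s) + (\<Sum>(s,t)\<in>(\<Union>p\<in>P. Q p). g t - g s) = (\<Sum>p\<in>P. g (snd p) - g (fst p))"
      by (simp add: Qg flip: sum.distrib)
    then show "(\<Sum>(s,t)\<in>R. g t - g s) + (\<Sum>(s,t)\<in>(\<Union>p\<in>P. Q p). g t - g s) = (\<Sum>(s,t)\<in>P. g t - g s)"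
      by (simp add: split_beta)
  qed
qed

subsection \<open>Exceptional sets of slopes\<close>

text \<open>The Vitali covering condition at a single point. Since \<open>x\<close> lies in the
  interior of the intervals, the points satisfying it form a G-delta set.\<close>

definition finely :: "(real \<times> real) set \<Rightarrow> real \<Rightarrow> bool" where
  "finely K x \<longleftrightarrow> (\<forall>d>0. \<exists>s t. (s,t) \<in> K \<and> s < x \<and> x < t \<and> t - s < d)"

lemma finelyD:
  assumes "finely K x" "d > 0"
  obtains s t where "(s,t) \<in> K" "s < x" "x < t" "t - s < d"
  using assms unfolding finely_def by blast

lemma finely_mono: "finely K x \<Longrightarrow> K \<subseteq> K' \<Longrightarrow> finely K' x"
  unfolding finely_def by (meson subsetD)

lemma finely_within_open:
  assumes "finely K x" "open U" "x \<in> U"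
  shows "finely {(s,t). (s,t) \<in> K \<and> {s..t} \<subseteq> U} x"
  unfolding finely_def
proof (intro allI impI)
  fix d :: real assume "d > 0"
  obtain e where e: "e > 0" "ball x e \<subseteq> U"
    using assms openE by blast
  obtain s t where "(s,t) \<in> K" "s < x" "x < t" "t - s < min d e"
    using finelyD[OF assms(1), of "min d e"] \<open>d > 0\<close> e by auto
  moreover from this have "{s..t} \<subseteq> ball x e" by (auto simp: dist_real_def)
  ultimately have "(s,t) \<in> {(s,t). (s,t) \<in> K \<and> {s..t} \<subseteq> U} \<and> s < x \<and> x < t \<and> t - s < d"
    using e by auto
  then show "\<exists>s t. (s,t) \<in> {(s,t). (s,t) \<in> K \<and> {s..t} \<subseteq> U} \<and> s < x \<and> x < t \<and> t - s < d"
    by blast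
qed

text \<open>The set is the countable intersection, over \<open>n\<close>, of the unions of the open
  intervals of length below \<open>inverse (Suc n)\<close> given by \<open>K\<close>. Each such
  union is open, whatever \<open>K\<close> is.\<close>

lemma sets_finely: "{x. finely K x} \<in> sets lebesgue"
proof -
  define G where "G n = (\<Union>(s,t)\<in>{(s,t)\<in>K. t - s < inverse (Suc n)}. {s<..<t})" for n :: nat
  have "{x. finely K x} = (\<Inter>n. G n)"
  proof
    show "{x. finely K x} \<subseteq> (\<Inter>n. G n)"
    proof clarify
      fix x n assume "finely K x"
      then obtain s t where "(s,t) \<in> K" "s < x" "x < t" "t - s < inverse (Suc n)"
        by (rule finelyD[of K x "inverse (Suc n)"]) auto
      then show "x \<in> G n" by (auto simp: G_def)
    qed
    show "(\<Inter>n. G n) \<subseteq> {x. finely K x}"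
      unfolding finely_def
    proof clarify
      fix x d :: real assume x: "x \<in> (\<Inter>n. G n)" and "d > 0"
      then obtain n where n: "inverse (Suc n) < d" using reals_Archimedean by blast
      from x have "x \<in> G n" by blast
      then obtain s t where "(s,t) \<in> K" "s < x" "x < t" "t - s < inverse (Suc n)"
        unfolding G_def by auto
      with n show "\<exists>s t. (s,t) \<in> K \<and> s < x \<and> x < t \<and> t - s < d" by fastforce
    qed
  qed
  moreover have "open (G n)" for n unfolding G_def by auto
  ultimately show ?thesis by auto
qed

section \<open>Vitali covering by finitely many intervals\<close>

lemma measure_packing:
  assumes "packing a b P"
  shows "(\<Union>(s,t)\<in>P. {s<..<t}) \<in> lmeasurable"
    "measure lebesgue (\<Union>(s,t)\<in>P. {s<..<t}) = (\<Sum>(s,t)\<in>P. t - s)"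
proof -
  have fin: "finite P" using assms packing_finite by blast
  show "(\<Union>(s,t)\<in>P. {s<..<t}) \<in> lmeasurable"
    using fin by (auto intro!: fmeasurable.finite_Union)
  have Ioo: "{u<..<v} \<in> lmeasurable" for u v :: real
    using lmeasurable_box[of u v] by simp
  have "measure lebesgue (\<Union>p\<in>P. case p of (s,t) \<Rightarrow> {s<..<t}) = (\<Sum>p\<in>P. measure lebesgue (case p of (s,t) \<Rightarrow> {s<..<t}))"
  proof (rule measure_finite_Union[OF fin])
    show "disjoint_family_on (\<lambda>(s,t). {s<..<t}) P" using assms by (simp add: packing_def)
    show "emeasure lebesgue (case p of (s,t) \<Rightarrow> {s<..<t}) \<noteq> \<infinity>" for p :: "real \<times> real"
      using fmeasurableD2[OF Ioo] by (simp add: split_beta)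
  qed auto
  also have "\<dots> = (\<Sum>(s,t)\<in>P. t - s)"
    by (rule sum.cong) (auto dest: packingD[OF assms])
  finally show "measure lebesgue (\<Union>(s,t)\<in>P. {s<..<t}) = (\<Sum>(s,t)\<in>P. t - s)" .
qed

text \<open>Vitali's theorem gives countably many disjoint intervals of \<open>K\<close> covering
  \<open>S\<close> up to a null set. The measure left uncovered by the first \<open>n\<close> of
  them decreases to zero, so a finite part already misses less than \<epsilon>.\<close>

lemma vitali_packing:
  assumes S: "S \<in> lmeasurable" and K: "\<And>s t. (s,t) \<in> K \<Longrightarrow> a \<le> s \<and> s < t \<and> t \<le> b"
    and fine: "\<And>x. x \<in> S \<Longrightarrow> finely K x" and "\<epsilon> > 0"
  obtains P where "packing a b P" "P \<subseteq> K"
    "measure lebesgue (S - (\<Union>(s,t)\<in>P. {s<..<t})) < \<epsilon>"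
proof -
  define I where "I = (\<lambda>(s::real,t). {s<..<t})"
  \<comment> \<open>Intervals are read as balls about their midpoints, to fit the ball version of
    Vitali's theorem.\<close>
  have ball: "ball (case p of (s,t) \<Rightarrow> (s+t)/2) (case p of (s,t) \<Rightarrow> (t-s)/2) = I p" for p :: "real \<times> real"
    by (cases p) (auto simp: I_def dist_real_def abs_if field_simps split: if_splits)
  have "\<exists>p. p \<in> K \<and> x \<in> ball (case p of (s,t) \<Rightarrow> (s+t)/2) (case p of (s,t) \<Rightarrow> (t-s)/2)
       \<and> (case p of (s,t) \<Rightarrow> (t-s)/2) < d" if x: "x \<in> S" "d > 0" for x d
  proof -
    obtain s t where st: "(s,t) \<in> K" "s < x" "x < t" "t - s < d"
      using finelyD[OF fine[OF x(1)] x(2)] .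
    then show ?thesis unfolding ball by (intro exI[of _ "(s,t)"]) (auto simp: I_def)
  qed
  then obtain C where C: "countable C" "C \<subseteq> K" "pairwise (\<lambda>p q. disjnt (I p) (I q)) C"
    "negligible (S - (\<Union>p\<in>C. I p))"
    using Vitali_covering_theorem_balls[of S K "\<lambda>(s,t). (s+t)/2" "\<lambda>(s,t). (t-s)/2"]
    unfolding ball by blast
  have pack: "packing a b P" if P: "finite P" "P \<subseteq> C" for P
    unfolding packing_def disjoint_family_on_def
  proof (intro conjI ballI impI)
    fix p q assume "p \<in> P" "q \<in> P" "p \<noteq> q"
    then have "disjnt (I p) (I q)" using C(3) P by (auto simp: pairwise_def)
    then show "(case p of (s, t) \<Rightarrow> {s<..<t}) \<inter> (case q of (s, t) \<Rightarrow> {s<..<t}) = {}"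
      by (simp add: I_def disjnt_def split_beta)
  qed (use P C(2) K in auto)
  show thesis
  proof (cases "C = {}")
    case True
    show ?thesis
      by (rule that[of "{}"]) (use True C(4) \<open>\<epsilon> > 0\<close> in \<open>auto simp: negligible_imp_measure0 intro!: packingI\<close>)
  next
    case False
    \<comment> \<open>\<open>from_nat_into C\<close> enumerates \<open>C\<close> only if
      \<open>C\<close> is nonempty, hence the case distinction; repetitions for finite
      \<open>C\<close> do no harm.\<close>
    define A where "A n = S - (\<Union>p\<in>from_nat_into C ` {..<n}. I p)" for n :: nat
    have [measurable]: "S \<in> sets lebesgue" using S by blast
    have op: "(\<Union>p\<in>X. I p) \<in> sets lebesgue" for X
    proof -
      have "open (\<Union>p\<in>X. I p)" by (auto simp: I_def)
      then show ?thesis by simp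
    qed
    have "(\<lambda>n. measure lebesgue (A n)) \<longlonglongrightarrow> measure lebesgue (\<Inter>n. A n)"
    proof (rule Lim_measure_decseq)
      show "range A \<subseteq> sets lebesgue"
        unfolding A_def using sets.Diff[OF \<open>S \<in> sets lebesgue\<close> op] by blast
      show "decseq A" unfolding A_def by (rule decseq_SucI) auto
      show "emeasure lebesgue (A i) \<noteq> \<infinity>" for i
        unfolding A_def using fmeasurableD2[OF fmeasurable_Diff[OF S op]] by (metis infinity_ennreal_def)
    qed
    moreover have "(\<Inter>n. A n) = S - (\<Union>p\<in>C. I p)"
    proof -
      have "(\<Union>n. from_nat_into C ` {..<n}) = C"
      proof -
        have "(\<Union>n. from_nat_into C ` {..<n}) = range (from_nat_into C)" by auto
        then show ?thesis using False C(1) by simp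
      qed
      then have "(\<Union>p\<in>C. I p) = (\<Union>n. \<Union>p\<in>from_nat_into C ` {..<n}. I p)" by blast
      then show ?thesis by (auto simp: A_def)
    qed
    ultimately have "(\<lambda>n. measure lebesgue (A n)) \<longlonglongrightarrow> 0"
      using C(4) by (simp add: negligible_imp_measure0)
    then obtain n where n: "measure lebesgue (A n) < \<epsilon>"
      using \<open>\<epsilon> > 0\<close> by (metis eventually_sequentially order_tendstoD(2) order_refl)
    have sub: "from_nat_into C ` {..<n} \<subseteq> C" using False from_nat_into by blast
    show ?thesis
      by (rule that[of "from_nat_into C ` {..<n}"])
        (use n sub C(2) in \<open>auto intro!: pack simp: A_def I_def\<close>)
  qed
qed

section \<open>Null sets of oscillating slopes\<close>

text \<open>Slopes of \<open>f\<close> below \<alpha> are expressed as slopes of the negative of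
  \<open>f\<close> above \<open>-\<alpha>\<close>, so that this one family serves both
  sides.\<close>

definition slopes_above :: "real \<Rightarrow> real \<Rightarrow> (real \<Rightarrow> real) \<Rightarrow> real \<Rightarrow> (real \<times> real) set" where
  "slopes_above a b f \<beta> = {(s,t). a \<le> s \<and> s < t \<and> t \<le> b \<and> \<beta> * (t - s) < f t - f s}"

lemma packing_slopes_above:
  assumes "packing a b P" "P \<subseteq> slopes_above a b f \<beta>"
  shows "\<beta> * (\<Sum>(s,t)\<in>P. t - s) \<le> (\<Sum>(s,t)\<in>P. f t - f s)"
proof -
  have "\<beta> * (\<Sum>(s,t)\<in>P. t - s) = (\<Sum>(s,t)\<in>P. \<beta> * (t - s))"
    by (simp add: sum_distrib_left split_beta)
  also have "\<dots> \<le> (\<Sum>(s,t)\<in>P. f t - f s)"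
    by (rule sum_mono) (use assms in \<open>auto simp: slopes_above_def\<close>)
  finally show ?thesis .
qed

lemma lmeasurable_finely_Ioo:
  "{x\<in>{a<..<b}. finely K x \<and> finely K' x} \<in> lmeasurable"
proof -
  have "{x\<in>{a<..<b}. finely K x \<and> finely K' x} = {a<..<b} \<inter> ({x. finely K x} \<inter> {x. finely K' x})" by auto
  moreover have "{a<..<b} \<in> lmeasurable" using lmeasurable_box[of a b] by simp
  ultimately show ?thesis
    by (simp add: fmeasurable_Int_fmeasurable sets_finely sets.Int)
qed

text \<open>With \<open>s\<close> the measure of \<open>E\<close>, the packings have lengths
  \<open>LP < s + \<epsilon>\<close> and \<open>LR >= s - 2 * \<epsilon>\<close>, while their total
  increments of \<open>f\<close> differ by less than \<eta>. Comparing slopes gives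
  \<open>(\<beta> - \<alpha>) * s <= C * \<eta>\<close> for every positive \<eta>.\<close>

lemma negligible_oscillating_slopes:
  assumes ac: "abs_cont_on a b f" and "\<alpha> < \<beta>"
  shows "negligible {x\<in>{a<..<b}. finely (slopes_above a b f \<beta>) x \<and>
    finely (slopes_above a b (\<lambda>x. - f x) (-\<alpha>)) x}" (is "negligible ?E")
proof -
  define E where "E = ?E"
  have E: "E \<in> lmeasurable" unfolding E_def by (rule lmeasurable_finely_Ioo)
  have EI: "E \<subseteq> {a<..<b}" by (auto simp: E_def)
  have Ef: "finely (slopes_above a b f \<beta>) x" "finely (slopes_above a b (\<lambda>x. - f x) (-\<alpha>)) x" if "x \<in> E" for x
    using that by (auto simp: E_def)
  define s where "s = measure lebesgue E"
  \<comment> \<open>Collects the errors of the final estimate: \<eta> from the increments over the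
    gaps, \<open>3 * \<bar>\<alpha>\<bar> * \<eta>\<close> from \<open>LP - LR\<close>, and
    \<open>2 * (\<beta> - \<alpha>) * \<eta>\<close> from the lower bound on
    \<open>LR\<close>.\<close>
  define C where "C = 1 + 3 * \<bar>\<alpha>\<bar> + 2 * (\<beta> - \<alpha>)"
  have C: "C > 0" using \<open>\<alpha> < \<beta>\<close> by (simp add: C_def)
  have bound: "(\<beta> - \<alpha>) * s \<le> C * \<eta>" if \<eta>: "\<eta> > 0" for \<eta>
  proof -
    obtain \<delta> where \<delta>: "\<delta> > 0" "\<And>P. packing a b P \<Longrightarrow> (\<Sum>(s,t)\<in>P. t - s) < \<delta> \<Longrightarrow> (\<Sum>(s,t)\<in>P. \<bar>f t - f s\<bar>) < \<eta>"
      by (rule abs_cont_on_packing[OF ac \<eta>]) blast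
    \<comment> \<open>The gaps turn out to have length below \<open>3 * \<epsilon>\<close>, which
      must stay below \<delta>; the bound by \<eta> lets the final estimate be stated in \<eta>
      alone.\<close>
    define \<epsilon> where "\<epsilon> = min (\<delta> / 4) \<eta>"
    have \<epsilon>: "\<epsilon> > 0" "\<epsilon> \<le> \<eta>" "3 * \<epsilon> < \<delta>" using \<delta> \<eta> by (auto simp: \<epsilon>_def)
    obtain T where T: "open T" "E \<subseteq> T" "T - E \<in> lmeasurable" "emeasure lebesgue (T - E) < ennreal \<epsilon>"
      using sets_lebesgue_outer_open[of E \<epsilon>] E \<epsilon> by blast
    define U where "U = T \<inter> {a<..<b}"
    have "{a<..<b} \<inter> T \<in> lmeasurable"
      using T(1) lmeasurable_box[of a b] by (intro fmeasurable_Int_fmeasurable) auto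
    then have U: "open U" "E \<subseteq> U" "U \<in> lmeasurable"
      using T EI by (auto simp: U_def Int_commute)
    have "measure lebesgue U \<le> measure lebesgue (E \<union> (T - E))"
      using U by (intro measure_mono_fmeasurable[OF _ _ fmeasurable.Un[OF E T(3)]]) (auto simp: U_def)
    also have "\<dots> \<le> s + measure lebesgue (T - E)"
      unfolding s_def using E T by (intro measure_Un_le) auto
    also have "measure lebesgue (T - E) < \<epsilon>"
      using T(4) \<epsilon> T(3) by (simp add: emeasure_eq_measure2 ennreal_less_iff)
    finally have mU: "measure lebesgue U < s + \<epsilon>" by simp
    \<comment> \<open>Keeping the closed intervals inside \<open>U\<close> bounds their total length
      by the measure of \<open>U\<close>, hence by \<open>s + \<epsilon>\<close>.\<close>
    obtain P where P: "packing a b P" "P \<subseteq> {(s,t). (s,t) \<in> slopes_above a b (\<lambda>x. - f x) (-\<alpha>) \<and> {s..t} \<subseteq> U}"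
      "measure lebesgue (E - (\<Union>(s,t)\<in>P. {s<..<t})) < \<epsilon>"
    proof (rule vitali_packing[OF E, of "{(s,t). (s,t) \<in> slopes_above a b (\<lambda>x. - f x) (-\<alpha>) \<and> {s..t} \<subseteq> U}" a b \<epsilon>])
      show "finely {(s,t). (s,t) \<in> slopes_above a b (\<lambda>x. - f x) (-\<alpha>) \<and> {s..t} \<subseteq> U} x" if "x \<in> E" for x
        using that U Ef by (intro finely_within_open) auto
    qed (use \<epsilon> in \<open>auto simp: slopes_above_def\<close>)
    define W where "W = (\<Union>(s,t)\<in>P. {s<..<t})"
    have W: "W \<in> lmeasurable" "measure lebesgue W = (\<Sum>(s,t)\<in>P. t - s)" "open W"
      using measure_packing[OF P(1)] by (auto simp: W_def)
    have EW: "E \<inter> W \<in> lmeasurable" using E W by blast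
    \<comment> \<open>Steep intervals lying inside members of \<open>P\<close>, so that the packing
      \<open>R\<close> drawn from them refines \<open>P\<close>.\<close>
    let ?K = "{(s,t). (s,t) \<in> slopes_above a b f \<beta> \<and> (\<exists>(c,d)\<in>P. c \<le> s \<and> t \<le> d)}"
    have Kfine: "finely ?K x" if x: "x \<in> E \<inter> W" for x
    proof -
      from x obtain c d where cd: "(c,d) \<in> P" "x \<in> {c<..<d}" by (auto simp: W_def)
      have "finely {(s,t). (s,t) \<in> slopes_above a b f \<beta> \<and> {s..t} \<subseteq> {c<..<d}} x"
        using x cd Ef by (intro finely_within_open) auto
      moreover have "{(s,t). (s,t) \<in> slopes_above a b f \<beta> \<and> {s..t} \<subseteq> {c<..<d}} \<subseteq> ?K"
      proof (rule subrelI)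
        fix s t assume "(s,t) \<in> {(s,t). (s,t) \<in> slopes_above a b f \<beta> \<and> {s..t} \<subseteq> {c<..<d}}"
        then have st: "(s,t) \<in> slopes_above a b f \<beta>" "{s..t} \<subseteq> {c<..<d}" by simp_all
        then have "s \<in> {s..t}" "t \<in> {s..t}" by (simp_all add: slopes_above_def)
        with st(2) have "s \<in> {c<..<d}" "t \<in> {c<..<d}" by (meson subsetD)+
        then have "c \<le> s \<and> t \<le> d" by simp
        with st(1) cd(1) show "(s,t) \<in> ?K" by auto
      qed
      ultimately show "finely ?K x" by (rule finely_mono)
    qed
    have Kbd: "a \<le> s \<and> s < t \<and> t \<le> b" if "(s,t) \<in> ?K" for s t
      using that by (simp add: slopes_above_def)
    obtain R where R: "packing a b R" "R \<subseteq> ?K" "measure lebesgue ((E \<inter> W) - (\<Union>(s,t)\<in>R. {s<..<t})) < \<epsilon>"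
      using vitali_packing[OF EW Kbd Kfine \<epsilon>(1)] by blast
    obtain Q where Q: "packing a b Q" "\<And>g::real\<Rightarrow>real. (\<Sum>(s,t)\<in>R. g t - g s) + (\<Sum>(s,t)\<in>Q. g t - g s) = (\<Sum>(s,t)\<in>P. g t - g s)"
      using packing_refine_gaps[OF P(1) R(1)] R(2) by fast
    define LP where "LP = (\<Sum>(s,t)\<in>P. t - s)"
    define LR where "LR = (\<Sum>(s,t)\<in>R. t - s)"
    have LQ: "(\<Sum>(s,t)\<in>Q. t - s) = LP - LR" using Q(2)[of "\<lambda>x. x"] by (simp add: LP_def LR_def)
    have LPs: "LP < s + \<epsilon>"
    proof -
      have "LP \<le> measure lebesgue U"
        unfolding LP_def W(2)[symmetric] using W U P(2)
        by (intro measure_mono_fmeasurable) (force simp: W_def)+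
      then show ?thesis using mU by simp
    qed
    \<comment> \<open>\<open>E\<close> splits into the part missed by \<open>P\<close> and the part
      covered by \<open>P\<close> but missed by \<open>R\<close>, each of measure below \<epsilon>,
      and the part covered by \<open>R\<close>.\<close>
    have LRs: "s \<le> LR + 2 * \<epsilon>"
    proof -
      let ?V = "\<Union>(s,t)\<in>R. {s<..<t}"
      note V = measure_packing[OF R(1)]
      have "s \<le> measure lebesgue (((E - W) \<union> ((E \<inter> W) - ?V)) \<union> ?V)"
        unfolding s_def using E W V by (intro measure_mono_fmeasurable) (auto intro!: fmeasurable.Un fmeasurable.Diff)
      also have "\<dots> \<le> measure lebesgue ((E - W) \<union> ((E \<inter> W) - ?V)) + measure lebesgue ?V"
        using E W V by (intro measure_Un_le) (auto intro!: fmeasurableD fmeasurable.Un fmeasurable.Diff)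
      also have "measure lebesgue ((E - W) \<union> ((E \<inter> W) - ?V)) \<le> measure lebesgue (E - W) + measure lebesgue ((E \<inter> W) - ?V)"
        using E W V by (intro measure_Un_le) (auto intro!: fmeasurableD fmeasurable.Diff)
      finally show ?thesis using P(3) R(3) V(2) by (simp add: W_def LR_def)
    qed
    have LQ0: "0 \<le> LP - LR"
      unfolding LQ[symmetric] by (rule sum_nonneg) (use packingD[OF Q(1)] in force)
    have LQ3: "LP - LR < 3 * \<epsilon>" using LPs LRs by simp
    then have "(\<Sum>(s,t)\<in>Q. t - s) < \<delta>" using LQ \<epsilon>(3) by simp
    then have "(\<Sum>(s,t)\<in>Q. \<bar>f t - f s\<bar>) < \<eta>" using \<delta>(2)[OF Q(1)] by simp
    moreover have "\<bar>\<Sum>(s,t)\<in>Q. f t - f s\<bar> \<le> (\<Sum>(s,t)\<in>Q. \<bar>f t - f s\<bar>)"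
      unfolding split_beta by (rule sum_abs)
    ultimately have fQ: "\<bar>\<Sum>(s,t)\<in>Q. f t - f s\<bar> < \<eta>" by simp
    have "\<beta> * LR \<le> (\<Sum>(s,t)\<in>R. f t - f s)"
      unfolding LR_def by (rule packing_slopes_above[OF R(1)]) (use R(2) in auto)
    moreover have "- \<alpha> * LP \<le> (\<Sum>(s,t)\<in>P. - f t - - f s)"
      unfolding LP_def by (rule packing_slopes_above[OF P(1), of "\<lambda>x. - f x"]) (use P(2) in auto)
    moreover have "(\<Sum>(s,t)\<in>P. - f t - - f s) = - (\<Sum>(s,t)\<in>P. f t - f s)"
      by (simp add: split_beta sum_negf[symmetric])
    \<comment> \<open>\<open>\<beta> * LR\<close> is at most the increment over \<open>R\<close>,
      which is the increment over \<open>P\<close> less that over \<open>Q\<close>, hence at most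
      \<open>\<alpha> * LP + \<eta>\<close>.\<close>
    ultimately have "\<beta> * LR - \<eta> \<le> \<alpha> * LP" using Q(2)[of f] fQ by simp
    then have "(\<beta> - \<alpha>) * LR \<le> \<eta> + \<alpha> * (LP - LR)" by (simp add: algebra_simps)
    also have "\<alpha> * (LP - LR) \<le> \<bar>\<alpha>\<bar> * (3 * \<eta>)"
      using LQ0 LQ3 \<epsilon> by (intro mult_mono) auto
    finally have "(\<beta> - \<alpha>) * LR \<le> \<eta> + \<bar>\<alpha>\<bar> * (3 * \<eta>)" by simp
    moreover have "(\<beta> - \<alpha>) * (s - 2 * \<eta>) \<le> (\<beta> - \<alpha>) * LR"
      using LRs \<epsilon> \<open>\<alpha> < \<beta>\<close> by (intro mult_left_mono) auto
    ultimately show ?thesis by (simp add: C_def algebra_simps)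
  qed
  have "s = 0"
  proof (rule ccontr)
    assume "s \<noteq> 0"
    then have "s > 0" by (simp add: s_def zero_less_measure_iff)
    then have pos: "(\<beta> - \<alpha>) * s > 0" using \<open>\<alpha> < \<beta>\<close> by simp
    \<comment> \<open>This choice of \<eta> makes the right side half of the left side.\<close>
    then have "(\<beta> - \<alpha>) * s \<le> C * ((\<beta> - \<alpha>) * s / (2 * C))"
      using C by (intro bound) simp
    also have "\<dots> = (\<beta> - \<alpha>) * s / 2" using C by simp
    finally show False using pos by linarith
  qed
  then have "negligible E" using E by (simp add: s_def negligible_iff_measure)
  then show ?thesis by (simp add: E_def)
qed

section \<open>Bounded variation and unbounded slopes\<close>

text \<open>Cells wholly left of \<open>x\<close> contribute full increments and cells right of it
  none, so the sum telescopes. In the induction step with \<open>x\<close> beyond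
  \<open>g n\<close>, clamping \<open>x\<close> and clamping \<open>g n\<close> agree on the first
  \<open>n\<close> cells.\<close>

lemma sum_clamp_increments:
  fixes f :: "real \<Rightarrow> real" and g :: "nat \<Rightarrow> real"
  assumes "mono g" "g 0 \<le> x" "x \<le> g n"
  shows "(\<Sum>m<n. f (max (g m) (min (g (Suc m)) x)) - f (g m)) = f x - f (g 0)"
  using assms(2,3)
proof (induction n arbitrary: x)
  case 0
  then show ?case by simp
next
  case (Suc n)
  have gn: "g m \<le> g n" if "m \<le> n" for m using assms(1) that by (simp add: mono_def)
  show ?case
  proof (cases "x \<le> g n")
    case True
    then have "max (g n) (min (g (Suc n)) x) = g n" by (simp add: max_def min_def)
    then show ?thesis using Suc.IH[of x] True Suc.prems by simp
  next
    case False
    have "(\<Sum>m<n. f (max (g m) (min (g (Suc m)) x)) - f (g m)) = (\<Sum>m<n. f (max (g m) (min (g (Suc m)) (g n))) - f (g m))"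
    proof (rule sum.cong)
      fix m assume "m \<in> {..<n}"
      then have "g (Suc m) \<le> g n" by (simp add: gn)
      then show "f (max (g m) (min (g (Suc m)) x)) - f (g m) = f (max (g m) (min (g (Suc m)) (g n))) - f (g m)"
        using False by (simp add: min_def)
    qed simp
    also have "\<dots> = f (g n) - f (g 0)" using Suc.IH[of "g n"] gn by simp
    finally show ?thesis using False Suc.prems by (simp add: max_def min_def)
  qed
qed

text \<open>Clamping to a grid of mesh \<open>< \<delta>\<close> splits every packing into boundedly many short ones.\<close>

lemma abs_cont_on_bounded_variation:
  assumes ac: "abs_cont_on a b f" and "a \<le> b"
  obtains B where "B > 0" "\<And>P. packing a b P \<Longrightarrow> (\<Sum>(s,t)\<in>P. \<bar>f t - f s\<bar>) \<le> B"
proof -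
  obtain \<delta> where \<delta>: "\<delta> > 0" "\<And>P. packing a b P \<Longrightarrow> (\<Sum>(s,t)\<in>P. t - s) < \<delta> \<Longrightarrow> (\<Sum>(s,t)\<in>P. \<bar>f t - f s\<bar>) < 1"
    using abs_cont_on_packing[OF ac, of 1] by auto
  \<comment> \<open>Makes the mesh \<open>(b - a) / n\<close> smaller than \<delta>;
    \<open>n\<close> is also the final bound, since each cell contributes at most one.\<close>
  obtain n :: nat where n: "(b - a) / \<delta> < n" using reals_Archimedean2 by blast
  then have n0: "n > 0" using \<open>a \<le> b\<close> \<delta>(1) by (cases n) (auto simp: field_simps)
  define g where "g m = a + real m * ((b - a) / n)" for m
  have mono: "mono g" using \<open>a \<le> b\<close> by (auto simp: mono_def g_def intro!: mult_right_mono divide_right_mono)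
  have g0: "g 0 = a" and gn: "g n = b" using n0 by (auto simp: g_def)
  have gm: "g (Suc m) - g m < \<delta>" for m
  proof -
    have "g (Suc m) - g m = (b - a) / n" by (simp add: g_def algebra_simps add_divide_distrib diff_divide_distrib)
    then show ?thesis using n n0 \<delta>(1) by (simp add: pos_divide_less_eq mult.commute)
  qed
  define c where "c m x = max (g m) (min (g (Suc m)) x)" for m x
  have bnd: "(\<Sum>(s,t)\<in>P. \<bar>f t - f s\<bar>) \<le> real n" if P: "packing a b P" for P
  proof -
    have fin: "finite P" using P packing_finite by blast
    have one: "(\<Sum>(s,t)\<in>P. \<bar>f (c m t) - f (c m s)\<bar>) \<le> 1" if "m < n" for m
    proof -
      have mg: "g m \<le> g (Suc m)" using mono by (simp add: mono_def)
      have cmono: "c m x \<le> c m y" if "x \<le> y" for x y using that by (auto simp: c_def)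
      have crange: "g m \<le> c m x" "c m x \<le> g (Suc m)" for x using mg by (auto simp: c_def)
      have agb: "a \<le> g m" "g (Suc m) \<le> b"
        using mono g0 gn that by (metis mono_def le0, metis mono_def Suc_leI)
      \<comment> \<open>Intervals of \<open>P\<close> that miss the cell collapse to a point under
        clamping; \<open>packing_image\<close> discards them.\<close>
      obtain P' where P': "packing (g m) (g (Suc m)) P'"
        "\<And>G :: real \<Rightarrow> real \<Rightarrow> real. (\<And>x. G x x = 0) \<Longrightarrow> (\<Sum>p\<in>P. G (c m (fst p)) (c m (snd p))) = (\<Sum>(s,t)\<in>P'. G s t)"
      proof (rule packing_image[OF fin, of "g m" "\<lambda>p. c m (fst p)" "\<lambda>p. c m (snd p)" "g (Suc m)"])
        fix p assume "p \<in> P"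
        then have "fst p < snd p" using packingD(2)[OF P, of "fst p" "snd p"] by simp
        then show "g m \<le> c m (fst p) \<and> c m (fst p) \<le> c m (snd p) \<and> c m (snd p) \<le> g (Suc m)"
          using crange cmono by simp
      next
        fix p q assume "p \<in> P" "q \<in> P" "p \<noteq> q"
        then have "snd p \<le> fst q \<or> snd q \<le> fst p"
          using packing_ordered[OF P, of "fst p" "snd p" "fst q" "snd q"] by (simp add: prod_eq_iff)
        then have "c m (snd p) \<le> c m (fst q) \<or> c m (snd q) \<le> c m (fst p)" using cmono by blast
        then show "{c m (fst p)<..<c m (snd p)} \<inter> {c m (fst q)<..<c m (snd q)} = {}" by auto
      qed blast
      \<comment> \<open>The gaps left by \<open>P'\<close> have nonnegative length, so
        \<open>P'\<close> is no longer than the cell.\<close>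
      have "(\<Sum>(s,t)\<in>P'. t - s) \<le> g (Suc m) - g m"
      proof -
        obtain Q where Q: "packing (g m) (g (Suc m)) Q"
          "\<And>G::real\<Rightarrow>real. (\<Sum>(s,t)\<in>P'. G t - G s) + (\<Sum>(s,t)\<in>Q. G t - G s) = G (g (Suc m)) - G (g m)"
          using packing_gaps[OF P'(1) mg] by auto
        have "(\<Sum>(s,t)\<in>Q. t - s) \<ge> 0"
          by (rule sum_nonneg) (use packingD[OF Q(1)] in force)
        then show ?thesis using Q(2)[of "\<lambda>x. x"] by linarith
      qed
      then have "(\<Sum>(s,t)\<in>P'. t - s) < \<delta>" using gm[of m] by simp
      then have "(\<Sum>(s,t)\<in>P'. \<bar>f t - f s\<bar>) < 1"
        using \<delta>(2) packing_mono[OF P'(1) agb] by blast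
      then show ?thesis using P'(2)[of "\<lambda>s t. \<bar>f t - f s\<bar>"] by (simp add: split_beta)
    qed
    have "(\<Sum>(s,t)\<in>P. \<bar>f t - f s\<bar>) \<le> (\<Sum>(s,t)\<in>P. \<Sum>m<n. \<bar>f (c m t) - f (c m s)\<bar>)"
    proof (rule sum_mono, clarify)
      fix s t assume "(s,t) \<in> P"
      note st = packingD[OF P this]
      have "f t - f s = (\<Sum>m<n. f (c m t) - f (c m s))"
        using sum_clamp_increments[OF mono, of t n f] sum_clamp_increments[OF mono, of s n f] st
        by (simp add: g0 gn c_def sum_subtractf)
      then show "\<bar>f t - f s\<bar> \<le> (\<Sum>m<n. \<bar>f (c m t) - f (c m s)\<bar>)" by simp
    qed
    also have "\<dots> = (\<Sum>m<n. \<Sum>(s,t)\<in>P. \<bar>f (c m t) - f (c m s)\<bar>)"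
      unfolding split_beta by (rule sum.swap)
    also have "\<dots> \<le> (\<Sum>m<n. 1)" by (rule sum_mono) (use one in auto)
    finally show ?thesis by simp
  qed
  show thesis by (rule that[of "real n"]) (use n0 bnd in auto)
qed

text \<open>A packing with slopes above \<open>M\<close> that leaves less than half of the measure
  \<open>s\<close> of the set uncovered has total increment at least \<open>M * s / 2\<close>.
  Bounded variation forbids this for large \<open>M\<close> unless \<open>s = 0\<close>.\<close>

lemma negligible_unbounded_slopes:
  assumes ac: "abs_cont_on a b f"
  shows "negligible {x\<in>{a<..<b}. \<forall>M::nat. finely (slopes_above a b f M) x}" (is "negligible ?E")
proof (cases "a \<le> b")
  case True
  have eq: "?E = {a<..<b} \<inter> (\<Inter>M::nat. {x. finely (slopes_above a b f M) x})"
    by auto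
  have E: "?E \<in> lmeasurable"
    unfolding eq by (intro fmeasurable_Int_fmeasurable sets.countable_INT) (auto simp: sets_finely)
  define s where "s = measure lebesgue ?E"
  obtain B where B: "B > 0" "\<And>P. packing a b P \<Longrightarrow> (\<Sum>(s,t)\<in>P. \<bar>f t - f s\<bar>) \<le> B"
    by (rule abs_cont_on_bounded_variation[OF ac True]) blast
  have "s = 0"
  proof (rule ccontr)
    assume "s \<noteq> 0"
    then have "s > 0" by (simp add: s_def zero_less_measure_iff)
    obtain M :: nat where M: "2 * B / s < M" using reals_Archimedean2 by blast
    obtain P where P: "packing a b P" "P \<subseteq> slopes_above a b f M"
      "measure lebesgue (?E - (\<Union>(s,t)\<in>P. {s<..<t})) < s / 2"
      by (rule vitali_packing[OF E, of "slopes_above a b f M" a b "s / 2"])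
        (use \<open>s > 0\<close> in \<open>auto simp: slopes_above_def\<close>)
    let ?W = "\<Union>(s,t)\<in>P. {s<..<t}"
    note W = measure_packing[OF P(1)]
    have "s \<le> measure lebesgue ((?E - ?W) \<union> ?W)"
      unfolding s_def using E W by (intro measure_mono_fmeasurable) (auto intro!: fmeasurable.Un fmeasurable.Diff)
    also have "\<dots> \<le> measure lebesgue (?E - ?W) + measure lebesgue ?W"
      using E W by (intro measure_Un_le) (auto intro!: fmeasurableD fmeasurable.Diff)
    finally have "s / 2 \<le> (\<Sum>(s,t)\<in>P. t - s)" using P(3) W(2) by simp
    then have "M * (s / 2) \<le> M * (\<Sum>(s,t)\<in>P. t - s)" by (intro mult_left_mono) auto
    also have "\<dots> \<le> (\<Sum>(s,t)\<in>P. f t - f s)" by (rule packing_slopes_above[OF P(1,2)])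
    also have "\<dots> \<le> (\<Sum>(s,t)\<in>P. \<bar>f t - f s\<bar>)" by (rule sum_mono) auto
    also have "\<dots> \<le> B" by (rule B(2)[OF P(1)])
    finally show False using M \<open>s > 0\<close> by (simp add: field_simps)
  qed
  then show ?thesis using E by (simp add: s_def negligible_iff_measure)
qed auto

subsection \<open>Calculus of absolutely continuous functions\<close>

lemma abs_cont_on_subinterval:
  assumes "abs_cont_on a b f" "a \<le> c" "d \<le> b"
  shows "abs_cont_on c d f"
  unfolding abs_cont_on_def
proof (intro allI impI)
  fix \<epsilon> :: real assume "\<epsilon> > 0"
  then obtain \<delta> where \<delta>: "\<delta> > 0" "\<And>(n::nat) s t. (\<forall>m<n. a \<le> s m \<and> s m \<le> t m \<and> t m \<le> b) \<Longrightarrow>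
        disjoint_family_on (\<lambda>m. {s m<..<t m}) {..<n} \<Longrightarrow>
        (\<Sum>m<n. t m - s m) < \<delta> \<Longrightarrow> (\<Sum>m<n. \<bar>f (t m) - f (s m)\<bar>) < \<epsilon>"
    using assms(1) unfolding abs_cont_on_def by meson
  show "\<exists>\<delta>>0. \<forall>(n::nat) s t. (\<forall>m<n. c \<le> s m \<and> s m \<le> t m \<and> t m \<le> d) \<and>
        disjoint_family_on (\<lambda>m. {s m<..<t m}) {..<n} \<and>
        (\<Sum>m<n. t m - s m) < \<delta> \<longrightarrow> (\<Sum>m<n. \<bar>f (t m) - f (s m)\<bar>) < \<epsilon>"
    using \<delta>(1) assms(2,3) by (intro exI[of _ \<delta>]) (auto intro!: \<delta>(2) elim: order_trans)
qed

lemma abs_cont_on_imp_continuous_on: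
  assumes ac: "abs_cont_on a b f"
  shows "continuous_on {a..b} f"
  unfolding continuous_on_iff
proof (intro ballI allI impI)
  fix x \<epsilon> :: real assume x: "x \<in> {a..b}" and "\<epsilon> > 0"
  obtain \<delta> where \<delta>: "\<delta> > 0" "\<And>P. packing a b P \<Longrightarrow> (\<Sum>(s,t)\<in>P. t - s) < \<delta> \<Longrightarrow> (\<Sum>(s,t)\<in>P. \<bar>f t - f s\<bar>) < \<epsilon>"
    by (rule abs_cont_on_packing[OF ac \<open>\<epsilon> > 0\<close>]) blast
  have *: "\<bar>f t - f s\<bar> < \<epsilon>" if "a \<le> s" "s < t" "t \<le> b" "t - s < \<delta>" for s t
    using \<delta>(2)[of "{(s,t)}"] that by (auto intro!: packingI)
  have "dist (f y) (f x) < \<epsilon>" if "y \<in> {a..b}" "dist y x < \<delta>" for y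
  proof (cases y x rule: linorder_cases)
    case less
    then show ?thesis using *[of y x] that x by (auto simp: dist_real_def)
  next
    case equal
    then show ?thesis using \<open>\<epsilon> > 0\<close> by simp
  next
    case greater
    then show ?thesis using *[of x y] that x by (auto simp: dist_real_def)
  qed
  then show "\<exists>\<delta>>0. \<forall>y\<in>{a..b}. dist y x < \<delta> \<longrightarrow> dist (f y) (f x) < \<epsilon>"
    using \<delta>(1) by blast
qed

text \<open>Both factors are bounded by some \<open>M\<close> on the compact interval, and an
  increment of the product is \<open>(f t - f s) * g t + f s * (g t - g s)\<close>.\<close>

lemma abs_cont_on_mult:
  assumes f: "abs_cont_on a b f" and g: "abs_cont_on a b g"
  shows "abs_cont_on a b (\<lambda>x. f x * g x)"
  unfolding abs_cont_on_def
proof (intro allI impI)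
  fix \<epsilon> :: real assume \<epsilon>: "\<epsilon> > 0"
  have "bounded (f ` {a..b})" "bounded (g ` {a..b})"
    using f g by (auto intro!: compact_imp_bounded compact_continuous_image abs_cont_on_imp_continuous_on)
  then obtain A B where A: "\<forall>y\<in>f ` {a..b}. norm y \<le> A" and B: "\<forall>y\<in>g ` {a..b}. norm y \<le> B"
    unfolding bounded_iff by blast
  define M where "M = \<bar>A\<bar> + \<bar>B\<bar> + 1"
  have M: "M > 0" "\<And>x. x \<in> {a..b} \<Longrightarrow> \<bar>f x\<bar> \<le> M" "\<And>x. x \<in> {a..b} \<Longrightarrow> \<bar>g x\<bar> \<le> M"
    using A B by (force simp: M_def)+
  define e where "e = \<epsilon> / (2 * M)"
  have "e > 0" using \<epsilon> M by (simp add: e_def)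
  obtain d1 where d1: "d1 > 0" "\<And>(n::nat) s t. (\<forall>m<n. a \<le> s m \<and> s m \<le> t m \<and> t m \<le> b) \<Longrightarrow>
        disjoint_family_on (\<lambda>m. {s m<..<t m}) {..<n} \<Longrightarrow>
        (\<Sum>m<n. t m - s m) < d1 \<Longrightarrow> (\<Sum>m<n. \<bar>f (t m) - f (s m)\<bar>) < e"
    using f \<open>e > 0\<close> unfolding abs_cont_on_def by meson
  obtain d2 where d2: "d2 > 0" "\<And>(n::nat) s t. (\<forall>m<n. a \<le> s m \<and> s m \<le> t m \<and> t m \<le> b) \<Longrightarrow>
        disjoint_family_on (\<lambda>m. {s m<..<t m}) {..<n} \<Longrightarrow>
        (\<Sum>m<n. t m - s m) < d2 \<Longrightarrow> (\<Sum>m<n. \<bar>g (t m) - g (s m)\<bar>) < e"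
    using g \<open>e > 0\<close> unfolding abs_cont_on_def by meson
  show "\<exists>\<delta>>0. \<forall>(n::nat) s t. (\<forall>m<n. a \<le> s m \<and> s m \<le> t m \<and> t m \<le> b) \<and>
        disjoint_family_on (\<lambda>m. {s m<..<t m}) {..<n} \<and>
        (\<Sum>m<n. t m - s m) < \<delta> \<longrightarrow> (\<Sum>m<n. \<bar>f (t m) * g (t m) - f (s m) * g (s m)\<bar>) < \<epsilon>"
  proof (intro exI[of _ "min d1 d2"] conjI allI impI; (elim conjE)?)
    show "min d1 d2 > 0" using d1 d2 by simp
    fix n :: nat and s t :: "nat \<Rightarrow> real"
    assume st: "\<forall>m<n. a \<le> s m \<and> s m \<le> t m \<and> t m \<le> b"
      and disj: "disjoint_family_on (\<lambda>m. {s m<..<t m}) {..<n}"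
      and len: "(\<Sum>m<n. t m - s m) < min d1 d2"
    have "(\<Sum>m<n. \<bar>f (t m) * g (t m) - f (s m) * g (s m)\<bar>) \<le>
      (\<Sum>m<n. M * (\<bar>f (t m) - f (s m)\<bar> + \<bar>g (t m) - g (s m)\<bar>))"
    proof (rule sum_mono)
      fix m assume "m \<in> {..<n}"
      then have in': "s m \<in> {a..b}" "t m \<in> {a..b}" using st by force+
      have "f (t m) * g (t m) - f (s m) * g (s m) = (f (t m) - f (s m)) * g (t m) + f (s m) * (g (t m) - g (s m))"
        by (simp add: algebra_simps)
      also have "\<bar>\<dots>\<bar> \<le> \<bar>f (t m) - f (s m)\<bar> * \<bar>g (t m)\<bar> + \<bar>f (s m)\<bar> * \<bar>g (t m) - g (s m)\<bar>"
        by (metis abs_triangle_ineq abs_mult)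
      also have "\<dots> \<le> \<bar>f (t m) - f (s m)\<bar> * M + M * \<bar>g (t m) - g (s m)\<bar>"
        using M(2)[OF in'(1)] M(3)[OF in'(2)] by (intro add_mono mult_mono) auto
      finally show "\<bar>f (t m) * g (t m) - f (s m) * g (s m)\<bar> \<le> M * (\<bar>f (t m) - f (s m)\<bar> + \<bar>g (t m) - g (s m)\<bar>)"
        by (simp add: algebra_simps)
    qed
    also have "\<dots> = M * ((\<Sum>m<n. \<bar>f (t m) - f (s m)\<bar>) + (\<Sum>m<n. \<bar>g (t m) - g (s m)\<bar>))"
      by (simp only: distrib_left sum.distrib sum_distrib_left)
    also have "\<dots> < M * (e + e)"
      using d1(2)[OF st disj] d2(2)[OF st disj] len M(1) by (intro mult_strict_left_mono add_strict_mono) auto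
    also have "\<dots> = \<epsilon>" using M(1) by (simp add: e_def field_simps)
    finally show "(\<Sum>m<n. \<bar>f (t m) * g (t m) - f (s m) * g (s m)\<bar>) < \<epsilon>" .
  qed
qed

text \<open>A continuous derivative is bounded on the compact interval, so \<open>g\<close> is
  Lipschitz there. Derivatives are taken within the interval, which admits indefinite integrals as
  \<open>g\<close>.\<close>

lemma abs_cont_on_C1:
  assumes deriv: "\<And>x. x \<in> {a..b} \<Longrightarrow> (g has_real_derivative g' x) (at x within {a..b})"
    and cont: "continuous_on {a..b} g'"
  shows "abs_cont_on a b g"
proof -
  have "bounded (g' ` {a..b})"
    using cont by (auto intro!: compact_imp_bounded compact_continuous_image)
  then obtain A where A: "\<forall>y\<in>g' ` {a..b}. norm y \<le> A"
    unfolding bounded_iff by blast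
  define C where "C = \<bar>A\<bar> + 1"
  have C: "C > 0" "\<And>x. x \<in> {a..b} \<Longrightarrow> norm (g' x) \<le> C" using A by (force simp: C_def)+
  have lip: "\<bar>g t - g s\<bar> \<le> C * (t - s)" if "a \<le> s" "s \<le> t" "t \<le> b" for s t
    using field_differentiable_bound[of "{a..b}" g g' C t s] deriv C that by simp
  show ?thesis
    unfolding abs_cont_on_def
  proof (intro allI impI)
    fix \<epsilon> :: real assume \<epsilon>: "\<epsilon> > 0"
    show "\<exists>\<delta>>0. \<forall>(n::nat) s t. (\<forall>m<n. a \<le> s m \<and> s m \<le> t m \<and> t m \<le> b) \<and>
        disjoint_family_on (\<lambda>m. {s m<..<t m}) {..<n} \<and>
        (\<Sum>m<n. t m - s m) < \<delta> \<longrightarrow> (\<Sum>m<n. \<bar>g (t m) - g (s m)\<bar>) < \<epsilon>"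
    proof (intro exI[of _ "\<epsilon> / C"] conjI allI impI; (elim conjE)?)
      show "\<epsilon> / C > 0" using \<epsilon> C by simp
      fix n :: nat and s t :: "nat \<Rightarrow> real"
      assume st: "\<forall>m<n. a \<le> s m \<and> s m \<le> t m \<and> t m \<le> b" and len: "(\<Sum>m<n. t m - s m) < \<epsilon> / C"
      have "(\<Sum>m<n. \<bar>g (t m) - g (s m)\<bar>) \<le> (\<Sum>m<n. C * (t m - s m))"
        by (rule sum_mono) (use st lip in auto)
      also have "\<dots> = C * (\<Sum>m<n. t m - s m)" by (simp add: sum_distrib_left)
      also have "\<dots> < \<epsilon>" using len C(1) by (simp add: pos_less_divide_eq mult.commute)
      finally show "(\<Sum>m<n. \<bar>g (t m) - g (s m)\<bar>) < \<epsilon>" .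
    qed
  qed
qed

section \<open>Differentiability almost everywhere\<close>

lemma not_finely_slopes_above:
  assumes "\<not> finely (slopes_above a b f \<beta>) x"
  obtains d where "d > 0"
    "\<And>s t. a \<le> s \<Longrightarrow> s < x \<Longrightarrow> x < t \<Longrightarrow> t \<le> b \<Longrightarrow> t - s < d \<Longrightarrow> f t - f s \<le> \<beta> * (t - s)"
proof -
  obtain d where d: "d > 0" "\<And>s t. (s,t) \<in> slopes_above a b f \<beta> \<Longrightarrow> s < x \<Longrightarrow> x < t \<Longrightarrow> \<not> t - s < d"
    using assms unfolding finely_def by blast
  show thesis
    by (rule that[OF d(1)]) (use d(2) in \<open>force simp: slopes_above_def not_less\<close>)
qed

lemma slopes_above_antimono: "\<beta> \<le> \<beta>' \<Longrightarrow> slopes_above a b f \<beta>' \<subseteq> slopes_above a b f \<beta>"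
proof (rule subrelI)
  fix s t assume "\<beta> \<le> \<beta>'" and st: "(s,t) \<in> slopes_above a b f \<beta>'"
  then have "\<beta> * (t - s) \<le> \<beta>' * (t - s)" by (intro mult_right_mono) (auto simp: slopes_above_def)
  also have "\<dots> < f t - f s" using st by (simp add: slopes_above_def)
  finally show "(s,t) \<in> slopes_above a b f \<beta>" using st by (simp add: slopes_above_def)
qed

text \<open>Differentiability in the form of the straddle lemma: increments over intervals that
  contain \<open>x\<close>, possibly as an endpoint. It is the estimate needed for an interval
  tagged at \<open>x\<close> in a Riemann sum.\<close>

definition straddle_deriv :: "real \<Rightarrow> real \<Rightarrow> (real \<Rightarrow> real) \<Rightarrow> real \<Rightarrow> real \<Rightarrow> bool" where
  "straddle_deriv a b f x L \<longleftrightarrow> (\<forall>\<epsilon>>0. \<exists>d>0. \<forall>s t. a \<le> s \<and> s \<le> x \<and> x \<le> t \<and> t \<le> b \<and> t - s < d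
      \<longrightarrow> \<bar>f t - f s - L * (t - s)\<bar> \<le> \<epsilon> * (t - s))"

lemma straddle_derivD:
  assumes "straddle_deriv a b f x L" "\<epsilon> > 0"
  obtains d where "d > 0" "\<And>s t. a \<le> s \<Longrightarrow> s \<le> x \<Longrightarrow> x \<le> t \<Longrightarrow> t \<le> b \<Longrightarrow> t - s < d
      \<Longrightarrow> \<bar>f t - f s - L * (t - s)\<bar> \<le> \<epsilon> * (t - s)"
proof -
  from assms obtain d where "d > 0" "\<forall>s t. a \<le> s \<and> s \<le> x \<and> x \<le> t \<and> t \<le> b \<and> t - s < d
      \<longrightarrow> \<bar>f t - f s - L * (t - s)\<bar> \<le> \<epsilon> * (t - s)"
    unfolding straddle_deriv_def by blast
  then show thesis by (intro that) auto
qed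

text \<open>Vitali covers only control intervals with \<open>x\<close> in the interior. By
  continuity the estimate passes to the limit as one endpoint tends to \<open>x\<close>.\<close>

lemma straddle_deriv_open:
  assumes cont: "continuous_on {a..b} f" and x: "x \<in> {a<..<b}"
    and *: "\<And>\<epsilon>. \<epsilon> > 0 \<Longrightarrow> \<exists>d>0. \<forall>s t. a \<le> s \<and> s < x \<and> x < t \<and> t \<le> b \<and> t - s < d
      \<longrightarrow> \<bar>f t - f s - L * (t - s)\<bar> \<le> \<epsilon> * (t - s)"
  shows "straddle_deriv a b f x L"
  unfolding straddle_deriv_def
proof (intro allI impI)
  fix \<epsilon> :: real assume "\<epsilon> > 0"
  from *[OF this] obtain d where d: "d > 0" "\<And>s t. a \<le> s \<Longrightarrow> s < x \<Longrightarrow> x < t \<Longrightarrow> t \<le> b \<Longrightarrow> t - s < d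
      \<Longrightarrow> \<bar>f t - f s - L * (t - s)\<bar> \<le> \<epsilon> * (t - s)" by blast
  have isC: "isCont f x" using cont x by (simp add: continuous_on_interior)
  show "\<exists>d>0. \<forall>s t. a \<le> s \<and> s \<le> x \<and> x \<le> t \<and> t \<le> b \<and> t - s < d
      \<longrightarrow> \<bar>f t - f s - L * (t - s)\<bar> \<le> \<epsilon> * (t - s)"
  proof (intro exI[of _ d] conjI allI impI d(1); elim conjE)
    fix s t assume st: "a \<le> s" "s \<le> x" "x \<le> t" "t \<le> b" "t - s < d"
    consider "s = x" "t = x" | "s = x" "x < t" | "s < x" "t = x" | "s < x" "x < t" using st by linarith
    then show "\<bar>f t - f s - L * (t - s)\<bar> \<le> \<epsilon> * (t - s)"
    proof cases
      case 1 then show ?thesis by simp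
    next
      case 4 then show ?thesis using d(2) st by simp
    next
      case 2
      \<comment> \<open>For \<open>y\<close> just below \<open>x\<close> and above
        \<open>max a (t - d)\<close>, the interval from \<open>y\<close> to \<open>t\<close> stays
        in range, has length below \<open>d\<close> and strictly straddles \<open>x\<close>.\<close>
      have ev: "\<forall>\<^sub>F y in at_left x. \<bar>f t - f y - L * (t - y)\<bar> \<le> \<epsilon> * (t - y)"
        using eventually_at_left_real[of "max a (t - d)" x] x st 2
        by (auto elim!: eventually_mono intro!: d(2))
      have lim: "((\<lambda>y. f y) \<longlongrightarrow> f x) (at_left x)"
        using isC by (simp add: isCont_def filterlim_at_split)
      have "((\<lambda>y. \<epsilon> * (t - y)) \<longlongrightarrow> \<epsilon> * (t - x)) (at_left x)"
        "((\<lambda>y. \<bar>f t - f y - L * (t - y)\<bar>) \<longlongrightarrow> \<bar>f t - f x - L * (t - x)\<bar>) (at_left x)"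
        by (auto intro!: tendsto_intros lim)
      from tendsto_le[OF _ this ev] show ?thesis using 2 by simp
    next
      case 3
      have ev: "\<forall>\<^sub>F y in at_right x. \<bar>f y - f s - L * (y - s)\<bar> \<le> \<epsilon> * (y - s)"
        using eventually_at_right_real[of x "min b (s + d)"] x st 3
        by (auto elim!: eventually_mono intro!: d(2))
      have lim: "((\<lambda>y. f y) \<longlongrightarrow> f x) (at_right x)"
        using isC by (simp add: isCont_def filterlim_at_split)
      have "((\<lambda>y. \<epsilon> * (y - s)) \<longlongrightarrow> \<epsilon> * (x - s)) (at_right x)"
        "((\<lambda>y. \<bar>f y - f s - L * (y - s)\<bar>) \<longlongrightarrow> \<bar>f x - f s - L * (x - s)\<bar>) (at_right x)"
        by (auto intro!: tendsto_intros lim)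
      from tendsto_le[OF _ this ev] show ?thesis using 3 by simp
    qed
  qed
qed

lemma straddle_deriv_imp_DERIV:
  assumes "straddle_deriv a b f x L" and x: "x \<in> {a<..<b}"
  shows "(f has_real_derivative L) (at x)"
  unfolding DERIV_def LIM_eq
proof (intro allI impI)
  fix r :: real assume r: "r > 0"
  then have "r / 2 > 0" by simp
  then obtain d where d: "d > 0" "\<And>s t. a \<le> s \<Longrightarrow> s \<le> x \<Longrightarrow> x \<le> t \<Longrightarrow> t \<le> b \<Longrightarrow> t - s < d
      \<Longrightarrow> \<bar>f t - f s - L * (t - s)\<bar> \<le> r / 2 * (t - s)"
    by (rule straddle_derivD[OF assms(1)]) blast
  define e where "e = min d (min (x - a) (b - x))"
  have "e > 0" using d x by (auto simp: e_def)
  have "norm ((f (x + h) - f x) / h - L) < r" if h: "h \<noteq> 0" "norm (h - 0) < e" for h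
  proof -
    have "\<bar>f (x + h) - f x - L * h\<bar> \<le> r / 2 * \<bar>h\<bar>"
    proof (cases "h > 0")
      case True
      then show ?thesis using d(2)[of x "x + h"] h x by (auto simp: e_def)
    next
      case False
      have "\<bar>f x - f (x + h) - L * (x - (x + h))\<bar> \<le> r / 2 * (x - (x + h))"
        using False h x by (intro d(2)) (auto simp: e_def)
      then show ?thesis using False by (simp add: abs_if algebra_simps split: if_splits)
    qed
    then have "\<bar>(f (x + h) - f x - L * h) / h\<bar> \<le> r / 2"
      using h(1) by (simp add: abs_divide pos_divide_le_eq)
    moreover have "(f (x + h) - f x - L * h) / h = (f (x + h) - f x) / h - L"
      using h(1) by (simp add: diff_divide_distrib)
    ultimately show ?thesis using r by simp
  qed
  then show "\<exists>s>0. \<forall>h. h \<noteq> 0 \<and> norm (h - 0) < s \<longrightarrow> norm ((f (x + h) - f x) / h - L) < r"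
    using \<open>e > 0\<close> by blast
qed

text \<open>\<open>L\<close> is the upper limit of slopes over shrinking intervals around
  \<open>x\<close>; \<open>lower\<close> makes \<open>A\<close> nonempty and \<open>upper\<close>
  bounds it. Slopes are eventually at most any number above \<open>L\<close>, and if they were
  repeatedly below some number less than \<open>L\<close>, a rational pair in between would violate
  \<open>osc\<close>.\<close>

lemma straddle_deriv_exists:
  assumes cont: "continuous_on {a..b} f" and x: "x \<in> {a<..<b}"
    and osc: "\<And>\<alpha> \<beta>. \<alpha> \<in> \<rat> \<Longrightarrow> \<beta> \<in> \<rat> \<Longrightarrow> \<alpha> < \<beta> \<Longrightarrow>
      \<not> (finely (slopes_above a b f \<beta>) x \<and> finely (slopes_above a b (\<lambda>x. - f x) (-\<alpha>)) x)"
    and upper: "\<not> finely (slopes_above a b f M) x"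
    and lower: "\<not> finely (slopes_above a b (\<lambda>x. - f x) M') x"
  shows "\<exists>L. straddle_deriv a b f x L"
proof -
  define A where "A = {\<beta>. finely (slopes_above a b f \<beta>) x}"
  have down: "\<beta> \<in> A" if "\<beta>' \<in> A" "\<beta> \<le> \<beta>'" for \<beta> \<beta>'
    using that finely_mono slopes_above_antimono unfolding A_def by blast
  have bdd: "bdd_above A"
    by (rule bdd_aboveI[of _ M]) (metis A_def down linear mem_Collect_eq upper)
  obtain d0 where d0: "d0 > 0" "\<And>s t. a \<le> s \<Longrightarrow> s < x \<Longrightarrow> x < t \<Longrightarrow> t \<le> b \<Longrightarrow> t - s < d0 \<Longrightarrow> - f t - - f s \<le> M' * (t - s)"
    by (rule not_finely_slopes_above[OF lower]) blast
  \<comment> \<open>Slopes near \<open>x\<close> are at least \<open>- M'\<close>, hence strictly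
    above \<open>- M' - 1\<close>; the symmetric interval of half-width \<open>e\<close> is a
    witness, short enough for both \<open>d\<close> and \<open>d0\<close>.\<close>
  have "- M' - 1 \<in> A"
    unfolding A_def mem_Collect_eq finely_def
  proof (intro allI impI)
    fix d :: real assume "d > 0"
    define e where "e = min (min d d0 / 3) (min (x - a) (b - x))"
    have e: "e > 0" "2 * e < d" "2 * e < d0" "a \<le> x - e" "x + e \<le> b"
    proof -
      have m: "min d d0 > 0" "min d d0 \<le> d" "min d d0 \<le> d0" using \<open>d > 0\<close> d0(1) by auto
      have "e \<le> min d d0 / 3" unfolding e_def by (rule min.cobounded1)
      with m show "2 * e < d" "2 * e < d0" by linarith+
    qed (use \<open>d > 0\<close> d0(1) x in \<open>auto simp: e_def\<close>)
    have "(x - e, x + e) \<in> slopes_above a b f (- M' - 1)"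
      using d0(2)[of "x - e" "x + e"] e by (auto simp: slopes_above_def algebra_simps)
    then show "\<exists>s t. (s,t) \<in> slopes_above a b f (- M' - 1) \<and> s < x \<and> x < t \<and> t - s < d"
      using e by (intro exI[of _ "x - e"] exI[of _ "x + e"]) auto
  qed
  then have ne: "A \<noteq> {}" by blast
  define L where "L = Sup A"
  have "straddle_deriv a b f x L"
  proof (rule straddle_deriv_open[OF cont x])
    fix \<epsilon> :: real assume "\<epsilon> > 0"
    have "L + \<epsilon> \<notin> A" using cSup_upper[OF _ bdd, of "L + \<epsilon>"] \<open>\<epsilon> > 0\<close> by (auto simp: L_def)
    then have "\<not> finely (slopes_above a b f (L + \<epsilon>)) x" by (simp add: A_def)
    then obtain d1 where d1: "d1 > 0" "\<And>s t. a \<le> s \<Longrightarrow> s < x \<Longrightarrow> x < t \<Longrightarrow> t \<le> b \<Longrightarrow> t - s < d1 \<Longrightarrow> f t - f s \<le> (L + \<epsilon>) * (t - s)"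
      by (rule not_finely_slopes_above) blast
    \<comment> \<open>Rational slopes between \<open>L - \<epsilon>\<close> and \<open>L\<close>:
      \<open>osc\<close> speaks of rational pairs, which keeps the exceptional set a countable
      union.\<close>
    obtain q2 where q2: "q2 \<in> \<rat>" "L - \<epsilon> < q2" "q2 < L" using Rats_dense_in_real[of "L - \<epsilon>" L] \<open>\<epsilon> > 0\<close> by auto
    obtain q1 where q1: "q1 \<in> \<rat>" "L - \<epsilon> < q1" "q1 < q2" using Rats_dense_in_real[OF q2(2)] by auto
    obtain \<beta> where "\<beta> \<in> A" "q2 < \<beta>" using q2(3) less_cSup_iff[OF ne bdd] unfolding L_def by blast
    then have "q2 \<in> A" using down by simp
    then have "\<not> finely (slopes_above a b (\<lambda>x. - f x) (- q1)) x"
      using osc[OF q1(1) q2(1) q1(3)] by (simp add: A_def)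
    then obtain d2 where d2: "d2 > 0" "\<And>s t. a \<le> s \<Longrightarrow> s < x \<Longrightarrow> x < t \<Longrightarrow> t \<le> b \<Longrightarrow> t - s < d2 \<Longrightarrow> - f t - - f s \<le> - q1 * (t - s)"
      by (rule not_finely_slopes_above) blast
    have "\<bar>f t - f s - L * (t - s)\<bar> \<le> \<epsilon> * (t - s)"
      if st: "a \<le> s" "s < x" "x < t" "t \<le> b" "t - s < min d1 d2" for s t
    proof -
      have "f t - f s \<le> (L + \<epsilon>) * (t - s)" using d1(2) st by simp
      moreover have "q1 * (t - s) \<le> f t - f s" using d2(2)[of s t] st by simp
      moreover have "(L - \<epsilon>) * (t - s) \<le> q1 * (t - s)" using q1 st by (intro mult_right_mono) auto
      ultimately show ?thesis by (simp add: abs_le_iff algebra_simps)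
    qed
    then show "\<exists>d>0. \<forall>s t. a \<le> s \<and> s < x \<and> x < t \<and> t \<le> b \<and> t - s < d
      \<longrightarrow> \<bar>f t - f s - L * (t - s)\<bar> \<le> \<epsilon> * (t - s)"
      using d1(1) d2(1) by (intro exI[of _ "min d1 d2"]) auto
  qed
  then show ?thesis by blast
qed

lemma abs_cont_on_uminus: "abs_cont_on a b f \<Longrightarrow> abs_cont_on a b (\<lambda>x. - f x)"
proof -
  have "\<bar>- u - - v\<bar> = \<bar>u - v\<bar>" for u v :: real by simp
  then show "abs_cont_on a b f \<Longrightarrow> abs_cont_on a b (\<lambda>x. - f x)"
    unfolding abs_cont_on_def by presburger
qed

text \<open>The exceptional set is the union of the oscillation sets over countably many rational
  pairs and of the two sets where the slopes of \<open>f\<close> or of its negative are unbounded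
  above.\<close>

lemma abs_cont_on_differentiable_AE:
  assumes ac: "abs_cont_on a b f"
  obtains N where "negligible N" "\<And>x. x \<in> {a<..<b} - N \<Longrightarrow> \<exists>L. straddle_deriv a b f x L"
proof -
  define osc where "osc = (\<lambda>(\<alpha>,\<beta>). {x\<in>{a<..<b}. finely (slopes_above a b f \<beta>) x \<and>
    finely (slopes_above a b (\<lambda>x. - f x) (-\<alpha>)) x})"
  define Q :: "(real \<times> real) set" where "Q = {(\<alpha>,\<beta>). \<alpha> \<in> \<rat> \<and> \<beta> \<in> \<rat> \<and> \<alpha> < \<beta>}"
  define N1 where "N1 = {x\<in>{a<..<b}. \<forall>M::nat. finely (slopes_above a b f M) x}"
  define N2 where "N2 = {x\<in>{a<..<b}. \<forall>M::nat. finely (slopes_above a b (\<lambda>x. - f x) M) x}"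
  have "Q \<subseteq> \<rat> \<times> \<rat>" by (auto simp: Q_def)
  then have "countable Q" using countable_rat by (meson countable_SIGMA countable_subset)
  moreover have "negligible (osc p)" if "p \<in> Q" for p
    using that negligible_oscillating_slopes[OF ac] by (auto simp: Q_def osc_def)
  ultimately have "negligible (\<Union>p\<in>Q. osc p)"
    by (intro negligible_countable_Union) auto
  moreover have "negligible N1" "negligible N2"
    unfolding N1_def N2_def using negligible_unbounded_slopes ac abs_cont_on_uminus by blast+
  ultimately have "negligible ((\<Union>p\<in>Q. osc p) \<union> N1 \<union> N2)" by (intro negligible_Un)
  then show thesis
  proof (rule that)
    fix x assume x: "x \<in> {a<..<b} - ((\<Union>p\<in>Q. osc p) \<union> N1 \<union> N2)"
    then obtain M M' :: nat where "\<not> finely (slopes_above a b f M) x" "\<not> finely (slopes_above a b (\<lambda>x. - f x) M') x"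
      by (auto simp: N1_def N2_def)
    then show "\<exists>L. straddle_deriv a b f x L"
      using x by (intro straddle_deriv_exists[OF abs_cont_on_imp_continuous_on[OF ac]]) (auto simp: Q_def osc_def)
  qed
qed

section \<open>Fundamental theorem of calculus and absolute integrability\<close>

text \<open>A gauge argument. Tags outside the null set \<open>N\<close> obey the straddle estimate;
  intervals tagged in \<open>N\<close> lie in an open set of measure below \<delta>, so absolute
  continuity bounds their increments.\<close>

lemma abs_cont_on_has_integral_deriv:
  assumes ac: "abs_cont_on a b f" and "a \<le> b"
  shows "(deriv f has_integral f b - f a) {a..b}"
proof (cases "a < b")
  case False
  then have "a = b" using \<open>a \<le> b\<close> by simp
  then show ?thesis by (simp add: has_integral_refl)
next
  case True
  obtain N0 where N0: "negligible N0" "\<And>x. x \<in> {a<..<b} - N0 \<Longrightarrow> \<exists>L. straddle_deriv a b f x L"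
    by (rule abs_cont_on_differentiable_AE[OF ac]) blast
  \<comment> \<open>The endpoints join the null set because \<open>deriv f\<close> there depends on
    values of \<open>f\<close> outside the interval.\<close>
  define N where "N = N0 \<union> {a,b}"
  have N: "negligible N" using N0 by (simp add: N_def negligible_Un)
  have sd: "straddle_deriv a b f x (deriv f x)" if "x \<in> {a..b} - N" for x
  proof -
    have x: "x \<in> {a<..<b}" "x \<notin> N0" using that by (auto simp: N_def)
    then obtain L where L: "straddle_deriv a b f x L" using N0 by blast
    then have "deriv f x = L" using straddle_deriv_imp_DERIV x DERIV_imp_deriv by blast
    then show ?thesis using L by simp
  qed
  \<comment> \<open>Zero on \<open>N\<close>, so that a tag in \<open>N\<close> leaves only the
    increment of \<open>f\<close> as its error; \<open>g\<close> and \<open>deriv f\<close> differ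
    at most on a null set.\<close>
  define g where "g x = (if x \<in> N then 0 else deriv f x)" for x
  have "(g has_integral f b - f a) {a..b}"
    unfolding has_integral_factor_content_real
  proof (intro allI impI)
    fix e :: real assume e: "e > 0"
    \<comment> \<open>Half of the permitted error \<open>e * (b - a)\<close>, one half for each kind
      of tag.\<close>
    define \<eta> where "\<eta> = e * (b - a) / 2"
    have "\<eta> > 0" using e True by (simp add: \<eta>_def)
    obtain \<delta> where \<delta>: "\<delta> > 0" "\<And>P. packing a b P \<Longrightarrow> (\<Sum>(s,t)\<in>P. t - s) < \<delta> \<Longrightarrow> (\<Sum>(s,t)\<in>P. \<bar>f t - f s\<bar>) < \<eta>"
      by (rule abs_cont_on_packing[OF ac \<open>\<eta> > 0\<close>]) blast
    have Nm: "N \<in> lmeasurable" "measure lebesgue N = 0"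
      using N by (auto simp: negligible_imp_measurable negligible_imp_measure0)
    obtain U where U: "open U" "N \<subseteq> U" "U - N \<in> lmeasurable" "emeasure lebesgue (U - N) < ennreal \<delta>"
      using sets_lebesgue_outer_open[of N \<delta>] Nm \<delta> by blast
    have Um: "U \<in> lmeasurable"
      using fmeasurable.Un[OF Nm(1) U(3)] U(2) by (simp add: Un_absorb1)
    have "measure lebesgue U \<le> measure lebesgue N + measure lebesgue (U - N)"
      using measure_Un_le[of N lebesgue "U - N"] Nm U by (simp add: Un_absorb1 fmeasurableD)
    also have "measure lebesgue (U - N) < \<delta>"
      using U(3,4) \<delta> by (simp add: emeasure_eq_measure2 ennreal_less_iff)
    finally have mU: "measure lebesgue U < \<delta>" using Nm by simp
    have "\<exists>d>0. x \<in> {a..b} - N \<longrightarrow> (\<forall>s t. a \<le> s \<and> s \<le> x \<and> x \<le> t \<and> t \<le> b \<and> t - s < d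
      \<longrightarrow> \<bar>f t - f s - deriv f x * (t - s)\<bar> \<le> e / 2 * (t - s))" for x
    proof (cases "x \<in> {a..b} - N")
      case True
      from e have "e / 2 > 0" by simp
      then obtain d where "d > 0" "\<And>s t. a \<le> s \<Longrightarrow> s \<le> x \<Longrightarrow> x \<le> t \<Longrightarrow> t \<le> b \<Longrightarrow> t - s < d
      \<Longrightarrow> \<bar>f t - f s - deriv f x * (t - s)\<bar> \<le> e / 2 * (t - s)"
        by (rule straddle_derivD[OF sd[OF True]]) blast
      then show ?thesis by blast
    qed (use zero_less_one in blast)
    then obtain d where d: "\<And>x. d x > 0" "\<And>x s t. x \<in> {a..b} - N \<Longrightarrow> a \<le> s \<Longrightarrow> s \<le> x \<Longrightarrow> x \<le> t \<Longrightarrow> t \<le> b \<Longrightarrow> t - s < d x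
      \<Longrightarrow> \<bar>f t - f s - deriv f x * (t - s)\<bar> \<le> e / 2 * (t - s)" by metis
    \<comment> \<open>The radius is halved because an interval may reach to both sides of its tag,
      and its length must be below \<open>d x\<close>.\<close>
    define \<gamma> where "\<gamma> x = (if x \<in> N then U else ball x (d x / 2))" for x
    have gauge: "gauge \<gamma>" using U d(1) by (auto simp: gauge_def \<gamma>_def)
    have riemann: "norm ((\<Sum>(x,k)\<in>p. measure lborel k *\<^sub>R g x) - (f b - f a)) \<le> e * measure lborel {a..b}"
      if p: "p tagged_division_of {a..b}" "\<gamma> fine p" for p
    proof -
      have pfin: "finite p" using p(1) by blast
      have K: "\<exists>s t. K = {s..t} \<and> a \<le> s \<and> s \<le> x \<and> x \<le> t \<and> t \<le> b" if xK: "(x,K) \<in> p" for x K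
      proof -
        obtain s t where "K = {s..t}" using tagged_division_ofD(4)[OF p(1) xK] by auto
        moreover have "x \<in> K" "K \<subseteq> {a..b}" using tagged_division_ofD(2,3)[OF p(1) xK] by auto
        ultimately show ?thesis by auto
      qed
      have KI: "K = {Inf K..Sup K}" "a \<le> Inf K" "Inf K \<le> x" "x \<le> Sup K" "Sup K \<le> b"
        "measure lborel K = Sup K - Inf K" if xK: "(x,K) \<in> p" for x K
        using K[OF xK] by auto
      define err where "err = (\<lambda>(x,K). measure lborel K * g x - (f (Sup K) - f (Inf K)))"
      define pN where "pN = {(x,K)\<in>p. x \<in> N}"
      have pN: "pN \<subseteq> p" "finite pN" using pfin by (auto simp: pN_def intro: finite_subset)
      \<comment> \<open>\<open>f b - f a\<close> is the sum of the increments over the division, so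
        the error splits into one term per tagged interval.\<close>
      have "(\<Sum>(x,k)\<in>p. measure lborel k *\<^sub>R g x) - (f b - f a) = (\<Sum>q\<in>p. err q)"
        unfolding additive_tagged_division_1[OF \<open>a \<le> b\<close> p(1), of f, symmetric]
        by (simp add: err_def sum_subtractf split_beta)
      also have "\<dots> = (\<Sum>q\<in>p - pN. err q) + (\<Sum>q\<in>pN. err q)"
        by (rule sum.subset_diff[OF pN(1) pfin])
      finally have split: "(\<Sum>(x,k)\<in>p. measure lborel k *\<^sub>R g x) - (f b - f a) = (\<Sum>q\<in>p - pN. err q) + (\<Sum>q\<in>pN. err q)" .
      have "\<bar>\<Sum>q\<in>p - pN. err q\<bar> \<le> (\<Sum>q\<in>p - pN. \<bar>err q\<bar>)" by (rule sum_abs)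
      also have "\<dots> \<le> (\<Sum>q\<in>p - pN. e / 2 * measure lborel (snd q))"
      proof (rule sum_mono)
        fix q assume q: "q \<in> p - pN"
        obtain x K where xK: "q = (x,K)" by fastforce
        then have xKp: "(x,K) \<in> p" "x \<notin> N" using q by (auto simp: pN_def)
        note KI' = KI[OF xKp(1)]
        have "K \<subseteq> ball x (d x / 2)" using fineD[OF p(2) xKp(1)] xKp(2) by (simp add: \<gamma>_def)
        moreover have "Inf K \<in> K" "Sup K \<in> K" using KI' by (metis atLeastAtMost_iff order_refl order_trans)+
        ultimately have "dist x (Inf K) < d x / 2" "dist x (Sup K) < d x / 2" by (auto simp: subset_iff)
        then have "Sup K - Inf K < d x" unfolding dist_real_def by linarith
        then have "\<bar>f (Sup K) - f (Inf K) - deriv f x * (Sup K - Inf K)\<bar> \<le> e / 2 * (Sup K - Inf K)"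
          using KI' xKp by (intro d(2)) auto
        then show "\<bar>err q\<bar> \<le> e / 2 * measure lborel (snd q)"
          using KI'(6) xKp(2) by (simp add: xK err_def g_def abs_minus_commute mult.commute)
      qed
      also have "\<dots> \<le> (\<Sum>q\<in>p. e / 2 * measure lborel (snd q))"
        by (rule sum_mono2[OF pfin]) (use e in auto)
      also have "\<dots> = e / 2 * (\<Sum>(x,k)\<in>p. measure lborel k)"
        by (simp add: sum_distrib_left split_beta)
      also have "\<dots> = \<eta>" using additive_content_tagged_division[of p a b] p(1) \<open>a \<le> b\<close> by (simp add: \<eta>_def)
      finally have part1: "\<bar>\<Sum>q\<in>p - pN. err q\<bar> \<le> \<eta>" .
      \<comment> \<open>Intervals tagged in \<open>N\<close> may be degenerate, hence the passage
        through \<open>packing_image\<close>.\<close>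
      obtain P where P: "packing a b P" "P \<subseteq> (\<lambda>q. (Inf (snd q), Sup (snd q))) ` pN"
        "\<And>G :: real \<Rightarrow> real \<Rightarrow> real. (\<And>x. G x x = 0) \<Longrightarrow> (\<Sum>q\<in>pN. G (Inf (snd q)) (Sup (snd q))) = (\<Sum>(s,t)\<in>P. G s t)"
      proof (rule packing_image[OF pN(2), of a "\<lambda>q. Inf (snd q)" "\<lambda>q. Sup (snd q)" b])
        fix q assume "q \<in> pN"
        then have "(fst q, snd q) \<in> p" using pN by auto
        from KI[OF this] show "a \<le> Inf (snd q) \<and> Inf (snd q) \<le> Sup (snd q) \<and> Sup (snd q) \<le> b" by simp
      next
        fix q r assume "q \<in> pN" "r \<in> pN" "q \<noteq> r"
        then have qr: "(fst q, snd q) \<in> p" "(fst r, snd r) \<in> p" "(fst q, snd q) \<noteq> (fst r, snd r)"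
          using pN by (auto simp: prod_eq_iff)
        have "interior (snd q) \<inter> interior (snd r) = {}" using tagged_division_ofD(5)[OF p(1) qr] .
        moreover have "interior (snd q) = {Inf (snd q)<..<Sup (snd q)}" "interior (snd r) = {Inf (snd r)<..<Sup (snd r)}"
          using KI(1)[OF qr(1)] KI(1)[OF qr(2)] by (metis interior_atLeastAtMost_real)+
        ultimately show "{Inf (snd q)<..<Sup (snd q)} \<inter> {Inf (snd r)<..<Sup (snd r)} = {}" by simp
      qed blast
      have "(\<Union>(s,t)\<in>P. {s<..<t}) \<subseteq> U"
      proof clarify
        fix y s t assume "(s,t) \<in> P" and y: "y \<in> {s<..<t}"
        then obtain x K where xK: "(x,K) \<in> pN" "s = Inf K" "t = Sup K" using P(2) by force
        then have "(x,K) \<in> p" "x \<in> N" by (auto simp: pN_def)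
        then have "K \<subseteq> U" using fineD[OF p(2), of x K] by (simp add: \<gamma>_def)
        moreover have "y \<in> K" using KI(1)[OF \<open>(x,K) \<in> p\<close>] y xK
          by (metis atLeastAtMost_iff greaterThanLessThan_iff less_imp_le)
        ultimately show "y \<in> U" by blast
      qed
      then have "(\<Sum>(s,t)\<in>P. t - s) \<le> measure lebesgue U"
        unfolding measure_packing(2)[OF P(1), symmetric]
        using measure_packing(1)[OF P(1)] Um by (intro measure_mono_fmeasurable) (auto simp: fmeasurableD)
      then have small: "(\<Sum>(s,t)\<in>P. \<bar>f t - f s\<bar>) < \<eta>" using mU \<delta>(2)[OF P(1)] by simp
      have "\<bar>\<Sum>q\<in>pN. err q\<bar> \<le> (\<Sum>q\<in>pN. \<bar>err q\<bar>)" by (rule sum_abs)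
      also have "\<dots> = (\<Sum>q\<in>pN. \<bar>f (Sup (snd q)) - f (Inf (snd q))\<bar>)"
        by (rule sum.cong) (auto simp: err_def pN_def g_def)
      also have "\<dots> = (\<Sum>(s,t)\<in>P. \<bar>f t - f s\<bar>)" using P(3)[of "\<lambda>s t. \<bar>f t - f s\<bar>"] by simp
      finally have part2: "\<bar>\<Sum>q\<in>pN. err q\<bar> \<le> \<eta>" using small by simp
      have "\<bar>(\<Sum>q\<in>p - pN. err q) + (\<Sum>q\<in>pN. err q)\<bar> \<le> \<eta> + \<eta>"
        using part1 part2 by linarith
      then show ?thesis unfolding split using \<open>a \<le> b\<close> by (simp add: \<eta>_def)
    qed
    show "\<exists>d. gauge d \<and> (\<forall>p. p tagged_division_of {a..b} \<and> d fine p \<longrightarrow>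
      norm ((\<Sum>(x,k)\<in>p. measure lborel k *\<^sub>R g x) - (f b - f a)) \<le> e * measure lborel {a..b})"
      by (intro exI[of _ \<gamma>] conjI allI impI gauge, elim conjE) (rule riemann)
  qed
  then show ?thesis
    by (rule has_integral_spike[OF N, rotated]) (simp add: g_def)
qed

text \<open>By the fundamental theorem on subintervals, integrals of \<open>deriv f\<close> over the
  pieces of a division are increments of \<open>f\<close>, whose absolute sum is at most the
  variation bound. This upgrades gauge integrability to the absolute integrability behind the
  Lebesgue integrals of the definitions.\<close>

lemma abs_cont_on_deriv_absolutely_integrable:
  assumes ac: "abs_cont_on a b f" and "a \<le> b"
  shows "deriv f absolutely_integrable_on {a..b}"
proof -
  obtain B where B: "\<And>P. packing a b P \<Longrightarrow> (\<Sum>(s,t)\<in>P. \<bar>f t - f s\<bar>) \<le> B"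
    by (rule abs_cont_on_bounded_variation[OF assms]) blast
  have "deriv f absolutely_integrable_on cbox a b"
  proof (rule bounded_variation_absolutely_integrable_interval)
    show "deriv f integrable_on cbox a b"
      using abs_cont_on_has_integral_deriv[OF assms] by (auto simp: integrable_on_def)
    fix D assume D: "D division_of cbox a b"
    have K: "K = {Inf K..Sup K}" "a \<le> Inf K" "Inf K \<le> Sup K" "Sup K \<le> b" if KD: "K \<in> D" for K
    proof -
      obtain s t where "K = {s..t}" "K \<noteq> {}" "K \<subseteq> {a..b}"
        using division_ofD(2,3,4)[OF D KD] by auto
      then show "K = {Inf K..Sup K}" "a \<le> Inf K" "Inf K \<le> Sup K" "Sup K \<le> b" by auto
    qed
    obtain P where P: "packing a b P"
      "\<And>G :: real \<Rightarrow> real \<Rightarrow> real. (\<And>x. G x x = 0) \<Longrightarrow> (\<Sum>K\<in>D. G (Inf K) (Sup K)) = (\<Sum>(s,t)\<in>P. G s t)"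
    proof (rule packing_image[OF division_of_finite[OF D], of a Inf Sup b])
      fix K assume "K \<in> D"
      from K[OF this] show "a \<le> Inf K \<and> Inf K \<le> Sup K \<and> Sup K \<le> b" by simp
    next
      fix K K' assume KK: "K \<in> D" "K' \<in> D" "K \<noteq> K'"
      have "interior K \<inter> interior K' = {}" using division_ofD(5)[OF D KK] .
      then show "{Inf K<..<Sup K} \<inter> {Inf K'<..<Sup K'} = {}"
        using K(1)[OF KK(1)] K(1)[OF KK(2)] by (metis interior_atLeastAtMost_real)
    qed blast
    have "(\<Sum>K\<in>D. norm (integral K (deriv f))) = (\<Sum>K\<in>D. \<bar>f (Sup K) - f (Inf K)\<bar>)"
    proof (rule sum.cong)
      fix K assume "K \<in> D"
      note K' = K[OF this]
      have "(deriv f has_integral f (Sup K) - f (Inf K)) {Inf K..Sup K}"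
        using K' by (intro abs_cont_on_has_integral_deriv abs_cont_on_subinterval[OF ac])
      then show "norm (integral K (deriv f)) = \<bar>f (Sup K) - f (Inf K)\<bar>"
        using K'(1) by (metis integral_unique real_norm_def)
    qed simp
    also have "\<dots> = (\<Sum>(s,t)\<in>P. \<bar>f t - f s\<bar>)" using P(2)[of "\<lambda>s t. \<bar>f t - f s\<bar>"] by simp
    also have "\<dots> \<le> B" by (rule B[OF P(1)])
    finally show "(\<Sum>K\<in>D. norm (integral K (deriv f))) \<le> B" .
  qed
  then show ?thesis by simp
qed

section \<open>Integration by parts\<close>

lemma abs_cont_on_deriv_times_continuous:
  fixes g :: "real \<Rightarrow> real"
  assumes "abs_cont_on a b f" "a \<le> b" "continuous_on {a..b} g"
  shows "(\<lambda>x. deriv f x * g x) absolutely_integrable_on {a..b}"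
proof -
  have "(\<lambda>x. g x * deriv f x) absolutely_integrable_on {a..b}"
    using assms
    by (intro absolutely_integrable_bounded_measurable_product_real abs_cont_on_deriv_absolutely_integrable)
      (auto intro!: continuous_imp_measurable_on_sets_lebesgue compact_imp_bounded compact_continuous_image)
  then show ?thesis by (simp add: mult.commute)
qed

text \<open>The product is absolutely continuous, so the fundamental theorem applies to it; outside
  a null set the product rule identifies its derivative.\<close>

lemma abs_cont_on_integration_by_parts:
  assumes f: "abs_cont_on a b f" and "a \<le> b"
    and g: "\<And>x. x \<in> {a..b} \<Longrightarrow> (g has_real_derivative g' x) (at x within {a..b})"
    and g': "continuous_on {a..b} g'"
  shows "integral {a..b} (\<lambda>x. deriv f x * g x) = f b * g b - f a * g a - integral {a..b} (\<lambda>x. f x * g' x)"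
proof -
  have contf: "continuous_on {a..b} f" by (rule abs_cont_on_imp_continuous_on[OF f])
  have contg: "continuous_on {a..b} g" using g DERIV_continuous_on by blast
  obtain N where N: "negligible N" "\<And>x. x \<in> {a<..<b} - N \<Longrightarrow> \<exists>L. straddle_deriv a b f x L"
    by (rule abs_cont_on_differentiable_AE[OF f]) blast
  have ac: "abs_cont_on a b (\<lambda>x. f x * g x)"
    using f abs_cont_on_C1[OF g g'] by (rule abs_cont_on_mult)
  have "f b * g b - f a * g a = integral {a..b} (deriv (\<lambda>x. f x * g x))"
    using abs_cont_on_has_integral_deriv[OF ac \<open>a \<le> b\<close>] by (simp add: integral_unique)
  also have "\<dots> = integral {a..b} (\<lambda>x. deriv f x * g x + f x * g' x)"
  \<comment> \<open>The endpoints are dropped since \<open>g\<close> is only assumed differentiable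
    within the interval there.\<close>
  proof (rule integral_spike[of "N \<union> {a,b}"])
    fix x assume x: "x \<in> {a..b} - (N \<union> {a,b})"
    then have x': "x \<in> {a<..<b}" "x \<notin> N" by auto
    then obtain L where "straddle_deriv a b f x L" using N by blast
    then have L: "(f has_real_derivative L) (at x)" using x'(1) by (rule straddle_deriv_imp_DERIV)
    have "(g has_real_derivative g' x) (at x)"
      using g[of x] x' by (simp add: at_within_Icc_at)
    with L have "((\<lambda>x. f x * g x) has_real_derivative L * g x + g' x * f x) (at x)" by (rule DERIV_mult)
    then show "deriv f x * g x + f x * g' x = deriv (\<lambda>x. f x * g x) x"
      using DERIV_imp_deriv[OF L] by (simp add: DERIV_imp_deriv mult.commute)
  qed (use N in \<open>simp add: negligible_Un\<close>)
  also have "\<dots> = integral {a..b} (\<lambda>x. deriv f x * g x) + integral {a..b} (\<lambda>x. f x * g' x)"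
  proof (rule integral_add)
    show "(\<lambda>x. deriv f x * g x) integrable_on {a..b}"
      using abs_cont_on_deriv_times_continuous[OF f \<open>a \<le> b\<close> contg] by (simp add: absolutely_integrable_on_def)
    show "(\<lambda>x. f x * g' x) integrable_on {a..b}"
      using contf g' by (intro integrable_continuous_real continuous_on_mult)
  qed
  finally show ?thesis by simp
qed

subsection \<open>The covariance double integral\<close>

lemma set_lebesgue_integral_continuous:
  fixes f :: "real \<Rightarrow> real"
  assumes "continuous_on {a..b} f"
  shows "(LINT x:{a..b}|lebesgue. f x) = integral {a..b} f"
  by (rule set_lebesgue_integral_eq_integral(2)) (rule absolutely_integrable_continuous_real[OF assms])

lemma set_lebesgue_integral_deriv_times_continuous:
  fixes g :: "real \<Rightarrow> real"
  assumes "abs_cont_on a b f" "a \<le> b" "continuous_on {a..b} g"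
  shows "(LINT x:{a..b}|lebesgue. g x * deriv f x) = integral {a..b} (\<lambda>x. deriv f x * g x)"
  using set_lebesgue_integral_eq_integral(2)[OF abs_cont_on_deriv_times_continuous[OF assms]]
  by (simp add: mult.commute)

lemma Iint_eq: "abs_cont_on a b f \<Longrightarrow> a \<le> b \<Longrightarrow> Iint f a b = integral {a..b} (\<lambda>v. deriv f v * v)"
  unfolding Iint_def by (rule set_lebesgue_integral_deriv_times_continuous) (auto intro!: continuous_intros)

lemma Ibar_eq: "abs_cont_on a b f \<Longrightarrow> a \<le> b \<Longrightarrow> Ibar f a b = integral {a..b} (\<lambda>v. deriv f v * (1 - v))"
  unfolding Ibar_def by (rule set_lebesgue_integral_deriv_times_continuous) (auto intro!: continuous_intros)

text \<open>Meant for the kernel: for fixed \<open>w\<close>, each of its two branches is affine in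
  \<open>v\<close>.\<close>

lemma integral_deriv_times_affine:
  assumes "abs_cont_on s t g" "s \<le> t"
  shows "integral {s..t} (\<lambda>v. deriv g v * (m + r * v)) =
    g t * (m + r * t) - g s * (m + r * s) - r * integral {s..t} g"
proof -
  have "integral {s..t} (\<lambda>v. deriv g v * (m + r * v)) =
    g t * (m + r * t) - g s * (m + r * s) - integral {s..t} (\<lambda>v. g v * r)"
    by (rule abs_cont_on_integration_by_parts[OF assms]) (auto intro!: derivative_eq_intros)
  then show ?thesis by (simp add: mult.commute)
qed

text \<open>For \<open>v\<close> at or above \<open>c\<close> and \<open>w\<close> at or below it,
  the kernel is \<open>w * (1 - v)\<close>, so the variables separate; this yields the term of
  \<open>V11\<close> that is a product of \<open>Iint\<close> and \<open>Ibar\<close>.\<close>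

lemma integral_Kker_below:
  assumes "w \<le> c"
  shows "integral {c..q} (\<lambda>v. deriv g v * Kker v w) = w * integral {c..q} (\<lambda>v. deriv g v * (1 - v))"
proof -
  have "integral {c..q} (\<lambda>v. deriv g v * Kker v w) = integral {c..q} (\<lambda>v. w * (deriv g v * (1 - v)))"
    by (rule integral_cong) (use assms in \<open>auto simp: Kker_def min_def algebra_simps\<close>)
  then show ?thesis by simp
qed

lemma continuous_on_Kker [continuous_intros]:
  "continuous_on A f \<Longrightarrow> continuous_on A g \<Longrightarrow> continuous_on A (\<lambda>x. Kker (f x) (g x))"
  unfolding Kker_def by (intro continuous_intros)

text \<open>Split at \<open>v = w\<close>, where the kernel changes from \<open>(1 - w) * v\<close>
  to \<open>w * (1 - v)\<close>. The boundary terms at \<open>w\<close> cancel because the two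
  branches agree there.\<close>

lemma integral_Kker_between:
  assumes g: "abs_cont_on c q g" and w: "c \<le> w" "w \<le> q"
  shows "integral {c..q} (\<lambda>v. deriv g v * Kker v w) =
    w * (1 - q) * g q - (1 - w) * (c * g c) + w * integral {c..q} g - integral {c..w} g"
proof -
  have cq: "c \<le> q" using w by simp
  have "(\<lambda>v. deriv g v * Kker v w) absolutely_integrable_on {c..q}"
    by (rule abs_cont_on_deriv_times_continuous[OF g cq]) (intro continuous_intros)
  then have "integral {c..q} (\<lambda>v. deriv g v * Kker v w) =
    integral {c..w} (\<lambda>v. deriv g v * Kker v w) + integral {w..q} (\<lambda>v. deriv g v * Kker v w)"
    using w by (intro Henstock_Kurzweil_Integration.integral_combine[symmetric]) (auto simp: absolutely_integrable_on_def)
  also have "integral {c..w} (\<lambda>v. deriv g v * Kker v w) = integral {c..w} (\<lambda>v. deriv g v * (0 + (1 - w) * v))"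
    by (rule integral_cong) (auto simp: Kker_def algebra_simps)
  also have "\<dots> = g w * (0 + (1 - w) * w) - g c * (0 + (1 - w) * c) - (1 - w) * integral {c..w} g"
    by (rule integral_deriv_times_affine[OF abs_cont_on_subinterval[OF g]]) (use w in auto)
  also have "integral {w..q} (\<lambda>v. deriv g v * Kker v w) = integral {w..q} (\<lambda>v. deriv g v * (w + (- w) * v))"
    by (rule integral_cong) (auto simp: Kker_def min_def algebra_simps)
  also have "\<dots> = g q * (w + (- w) * q) - g w * (w + (- w) * w) - (- w) * integral {w..q} g"
    by (rule integral_deriv_times_affine[OF abs_cont_on_subinterval[OF g]]) (use w in auto)
  finally have eq: "integral {c..q} (\<lambda>v. deriv g v * Kker v w) =
    g w * (0 + (1 - w) * w) - g c * (0 + (1 - w) * c) - (1 - w) * integral {c..w} g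
    + (g q * (w + (- w) * q) - g w * (w + (- w) * w) - (- w) * integral {w..q} g)" .
  have upper: "integral {w..q} g = integral {c..q} g - integral {c..w} g"
    using Henstock_Kurzweil_Integration.integral_combine[OF w, of g]
      abs_cont_on_imp_continuous_on[OF g] by (simp add: integrable_continuous_real)
  show ?thesis unfolding eq upper by (simp add: algebra_simps)
qed

text \<open>By \<open>integral_Kker_between\<close>, \<Phi> is a combination of \<open>w\<close>,
  \<open>1 - w\<close> and the indefinite integral \<open>G w\<close>, hence continuous. The term
  with \<open>G w\<close> is integrated by parts, the derivative of \<open>G\<close> being
  \<open>g\<close>.\<close>

lemma integral_deriv_Kker_between:
  assumes f: "abs_cont_on c d f" and g: "abs_cont_on c q g" and cd: "c \<le> d" and dq: "d \<le> q"
  defines "\<Phi> \<equiv> \<lambda>w. integral {c..q} (\<lambda>v. deriv g v * Kker v w)"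
  shows "(\<lambda>w. deriv f w * \<Phi> w) absolutely_integrable_on {c..d}"
    and "integral {c..d} (\<lambda>w. deriv f w * \<Phi> w) =
      (1 - q) * g q * integral {c..d} (\<lambda>w. deriv f w * w)
      - c * g c * integral {c..d} (\<lambda>w. deriv f w * (1 - w))
      + integral {c..q} g * (d * f d - c * f c - integral {c..d} f)
      - f d * integral {c..d} g + integral {c..d} (\<lambda>v. f v * g v)"
proof -
  define G where "G w = integral {c..w} g" for w
  have contg: "continuous_on {c..q} g" by (rule abs_cont_on_imp_continuous_on[OF g])
  have DG: "(G has_real_derivative g w) (at w within {c..d})" if "w \<in> {c..d}" for w
    unfolding G_def by (rule integral_has_real_derivative)
      (use that dq in \<open>auto intro: continuous_on_subset[OF contg]\<close>)
  have contG: "continuous_on {c..d} G" using DG DERIV_continuous_on by blast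
  have \<Phi>: "\<Phi> w = w * (1 - q) * g q - (1 - w) * (c * g c) + w * G q - G w" if "w \<in> {c..d}" for w
    unfolding \<Phi>_def G_def by (rule integral_Kker_between[OF g]) (use that dq in auto)
  have cont\<Phi>: "continuous_on {c..d} \<Phi>"
  proof -
    have "continuous_on {c..d} (\<lambda>w. w * (1 - q) * g q - (1 - w) * (c * g c) + w * G q - G w)"
      by (intro continuous_intros contG)
    then show ?thesis by (rule continuous_on_eq) (simp add: \<Phi>)
  qed
  show "(\<lambda>w. deriv f w * \<Phi> w) absolutely_integrable_on {c..d}"
    by (rule abs_cont_on_deriv_times_continuous[OF f cd cont\<Phi>])
  have int: "(\<lambda>w. deriv f w * h w) integrable_on {c..d}" if "continuous_on {c..d} h" for h
    using abs_cont_on_deriv_times_continuous[OF f cd that] by (simp add: absolutely_integrable_on_def)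
  have "integral {c..d} (\<lambda>w. deriv f w * \<Phi> w) =
    integral {c..d} (\<lambda>w. (1 - q) * g q * (deriv f w * w) - c * g c * (deriv f w * (1 - w))
      + G q * (deriv f w * w) - deriv f w * G w)"
    by (rule integral_cong) (simp add: \<Phi> algebra_simps)
  also have "\<dots> = (1 - q) * g q * integral {c..d} (\<lambda>w. deriv f w * w)
      - c * g c * integral {c..d} (\<lambda>w. deriv f w * (1 - w))
      + G q * integral {c..d} (\<lambda>w. deriv f w * w) - integral {c..d} (\<lambda>w. deriv f w * G w)"
    using int[of "\<lambda>w. w"] int[of "\<lambda>w. 1 - w"] int[OF contG]
    by (simp add: integral_diff integral_add integrable_diff integrable_add integrable_on_mult_right continuous_intros)
  \<comment> \<open>The boundary term at \<open>c\<close> vanishes in the end since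
    \<open>G c = 0\<close>.\<close>
  also have "integral {c..d} (\<lambda>w. deriv f w * G w) = f d * G d - f c * G c - integral {c..d} (\<lambda>v. f v * g v)"
    by (rule abs_cont_on_integration_by_parts[OF f cd DG continuous_on_subset[OF contg]]) (use dq in auto)
  \<comment> \<open>Only this integral against \<open>w\<close> is evaluated; the first two stay as
    they are, since they occur in \<open>V11\<close> as \<open>Iint\<close> and
    \<open>Ibar\<close>.\<close>
  also have "G q * integral {c..d} (\<lambda>w. deriv f w * w) = G q * (d * f d - c * f c - integral {c..d} f)"
    using integral_deriv_times_affine[OF f cd, of 0 1] by (simp add: mult.commute)
  finally show "integral {c..d} (\<lambda>w. deriv f w * \<Phi> w) =
      (1 - q) * g q * integral {c..d} (\<lambda>w. deriv f w * w)
      - c * g c * integral {c..d} (\<lambda>w. deriv f w * (1 - w))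
      + integral {c..q} g * (d * f d - c * f c - integral {c..d} f)
      - f d * integral {c..d} g + integral {c..d} (\<lambda>v. f v * g v)"
    by (simp add: G_def)
qed

text \<open>The outer range is cut at \<open>c\<close>: to the left the kernel separates, to the
  right \<open>integral_deriv_Kker_between\<close> applies.\<close>

lemma covariance_double_integral:
  assumes f: "abs_cont_on p d f" and g: "abs_cont_on c q g"
    and pc: "p \<le> c" and cd: "c \<le> d" and dq: "d \<le> q"
  shows "(LINT w:{p..d}|lebesgue. LINT v:{c..q}|lebesgue. Kker v w * deriv g v * deriv f w) =
      Iint f p c * Ibar g c q + (1 - q) * g q * Iint f c d - c * g c * Ibar f c d
      + integral {c..q} g * (d * f d - c * f c - integral {c..d} f)
      - f d * integral {c..d} g + integral {c..d} (\<lambda>v. f v * g v)"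
proof -
  define \<Phi> where "\<Phi> w = integral {c..q} (\<lambda>v. deriv g v * Kker v w)" for w
  have cq: "c \<le> q" using cd dq by simp
  have f1: "abs_cont_on p c f" and f2: "abs_cont_on c d f"
    using abs_cont_on_subinterval[OF f] pc cd by auto
  \<comment> \<open>Here \<open>deriv f w\<close> is a constant factor, so the identity holds for
    every \<open>w\<close>, including points where \<open>f\<close> has no derivative.\<close>
  have inner: "(LINT v:{c..q}|lebesgue. Kker v w * deriv g v * deriv f w) = deriv f w * \<Phi> w" for w
  proof -
    have "(LINT v:{c..q}|lebesgue. (Kker v w * deriv f w) * deriv g v) = integral {c..q} (\<lambda>v. deriv g v * (Kker v w * deriv f w))"
      by (rule set_lebesgue_integral_deriv_times_continuous[OF g cq]) (intro continuous_intros)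
    also have "\<dots> = integral {c..q} (\<lambda>v. deriv f w * (deriv g v * Kker v w))"
      by (rule integral_cong) simp
    also have "\<dots> = deriv f w * \<Phi> w" by (simp add: \<Phi>_def)
    finally show ?thesis by (simp add: mult_ac)
  qed
  define B where "B = integral {c..q} (\<lambda>v. deriv g v * (1 - v))"
  have low: "\<Phi> w = w * B" if "w \<in> {p..c}" for w
    unfolding \<Phi>_def B_def by (rule integral_Kker_below) (use that in auto)
  have "continuous_on {p..c} \<Phi>"
  proof -
    have "continuous_on {p..c} (\<lambda>w. w * B)" by (intro continuous_intros)
    then show ?thesis by (rule continuous_on_eq) (simp add: low)
  qed
  then have abs1: "(\<lambda>w. deriv f w * \<Phi> w) absolutely_integrable_on {p..c}"
    by (rule abs_cont_on_deriv_times_continuous[OF f1 pc])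
  have abs2: "(\<lambda>w. deriv f w * \<Phi> w) absolutely_integrable_on {c..d}"
    unfolding \<Phi>_def by (rule integral_deriv_Kker_between(1)[OF f2 g cd dq])
  have "{p..d} = {p..c} \<union> {c..d}" using pc cd by auto
  then have abs: "(\<lambda>w. deriv f w * \<Phi> w) absolutely_integrable_on {p..d}"
    using set_integrable_Un[OF abs1 abs2] by simp
  have "(LINT w:{p..d}|lebesgue. LINT v:{c..q}|lebesgue. Kker v w * deriv g v * deriv f w)
    = integral {p..d} (\<lambda>w. deriv f w * \<Phi> w)"
    unfolding inner by (rule set_lebesgue_integral_eq_integral(2)[OF abs])
  also have "\<dots> = integral {p..c} (\<lambda>w. deriv f w * \<Phi> w) + integral {c..d} (\<lambda>w. deriv f w * \<Phi> w)"
    using abs pc cd by (intro Henstock_Kurzweil_Integration.integral_combine[symmetric]) (auto simp: absolutely_integrable_on_def)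
  also have "integral {p..c} (\<lambda>w. deriv f w * \<Phi> w) = integral {p..c} (\<lambda>w. B * (deriv f w * w))"
    by (rule integral_cong) (simp add: low)
  also have "\<dots> = Iint f p c * Ibar g c q"
    by (simp add: Iint_eq[OF f1 pc] Ibar_eq[OF g cq] B_def)
  finally show ?thesis
    unfolding \<Phi>_def integral_deriv_Kker_between(2)[OF f2 g cd dq]
    by (simp add: Iint_eq[OF f2 cd] Ibar_eq[OF f2 cd])
qed

text \<open>The two triangles make up the square: for each \<open>v\<close> the inner integrals add
  up to the integral of \<open>f\<close> over the whole interval times \<open>g v\<close>. This
  handles the two triangular double integrals of \<open>V11\<close> together.\<close>

lemma product_integral_split:
  fixes f g :: "real \<Rightarrow> real"
  assumes f: "continuous_on {c..d} f" and g: "continuous_on {c..d} g"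
  shows "(LINT v:{c..d}|lebesgue. LINT w:{v..d}|lebesgue. f w * g v)
       + (LINT v:{c..d}|lebesgue. LINT w:{c..v}|lebesgue. f w * g v)
       = integral {c..d} f * integral {c..d} g"
proof -
  define F where "F v = integral {c..v} f" for v
  have int: "f integrable_on {c..d}" using f by (rule integrable_continuous_real)
  have contF: "continuous_on {c..d} F" unfolding F_def by (rule indefinite_integral_continuous_1[OF int])
  have lower: "(LINT w:{c..v}|lebesgue. f w) = F v" if v: "v \<in> {c..d}" for v
  proof -
    have "continuous_on {c..v} f" using v by (intro continuous_on_subset[OF f]) auto
    then show ?thesis by (simp add: set_lebesgue_integral_continuous F_def)
  qed
  have upper: "(LINT w:{v..d}|lebesgue. f w) = F d - F v" if v: "v \<in> {c..d}" for v
  proof -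
    have "continuous_on {v..d} f" using v by (intro continuous_on_subset[OF f]) auto
    moreover have "integral {v..d} f = F d - F v"
      using Henstock_Kurzweil_Integration.integral_combine[of c v d f] v int by (simp add: F_def)
    ultimately show ?thesis by (simp add: set_lebesgue_integral_continuous)
  qed
  have cont: "continuous_on {c..d} (\<lambda>v. (F d - F v) * g v)" "continuous_on {c..d} (\<lambda>v. F v * g v)"
    by (intro continuous_intros contF g)+
  have "(LINT v:{c..d}|lebesgue. LINT w:{v..d}|lebesgue. f w * g v) = integral {c..d} (\<lambda>v. (F d - F v) * g v)"
    unfolding set_lebesgue_integral_continuous[OF cont(1), symmetric]
    by (rule set_lebesgue_integral_cong) (auto simp: upper)
  moreover have "(LINT v:{c..d}|lebesgue. LINT w:{c..v}|lebesgue. f w * g v) = integral {c..d} (\<lambda>v. F v * g v)"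
    unfolding set_lebesgue_integral_continuous[OF cont(2), symmetric]
    by (rule set_lebesgue_integral_cong) (auto simp: lower)
  moreover have "integral {c..d} (\<lambda>v. (F d - F v) * g v) + integral {c..d} (\<lambda>v. F v * g v)
    = integral {c..d} (\<lambda>v. (F d - F v) * g v + F v * g v)"
    using cont by (intro integral_add[symmetric] integrable_continuous_real)
  moreover have "\<dots> = F d * integral {c..d} g"
    by (simp add: algebra_simps)
  ultimately show ?thesis by (simp add: F_def)
qed

lemma product_integral_iterated:
  fixes f g :: "real \<Rightarrow> real"
  assumes f: "continuous_on {c..d} f" and g: "continuous_on {d..q} g"
  shows "(LINT w:{c..d}|lebesgue. LINT v:{d..q}|lebesgue. f w * g v) = integral {c..d} f * integral {d..q} g"
  by (simp add: set_lebesgue_integral_continuous f g)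

theorem theorem3:
  fixes F :: "real \<Rightarrow> real" and h H :: "nat \<Rightarrow> real \<Rightarrow> real"
    and a b :: "nat \<Rightarrow> real" and k i j :: nat
  assumes "is_cdf F"
    and "i \<in> {1..k}" and "j \<in> {1..k}"
    and "\<And>r. r \<in> {1..k} \<Longrightarrow> H r = Hfun F (h r)"
    and "0 \<le> a i" and "a i \<le> a j" and "a j < 1 - b i" and "1 - b i \<le> 1 - b j" and "1 - b j \<le> 1"
    and "\<And>r. r \<in> {i, j} \<Longrightarrow> abs_cont_on (a r) (1 - b r) (H r)"
  shows "sigma2 H a b i j = Gam a b i j * V11 H a b i j"
proof -
  define p c d q where "p = a i" and "c = a j" and "d = 1 - b i" and "q = 1 - b j"
  note pcdq = p_def[symmetric] c_def[symmetric] d_def[symmetric] q_def[symmetric]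
  define f g where "f = H i" and "g = H j"
  have b: "b i = 1 - d" "b j = 1 - q" by (simp_all add: d_def q_def)
  have f: "abs_cont_on p d f" and g: "abs_cont_on c q g"
    using assms(10)[of i] assms(10)[of j] by (auto simp: p_def c_def d_def q_def f_def g_def)
  have ord: "p \<le> c" "c \<le> d" "d \<le> q" using assms(6-8) by (auto simp: p_def c_def d_def q_def)
  have contf: "continuous_on {c..d} f"
    using abs_cont_on_imp_continuous_on[OF f] ord by (auto intro: continuous_on_subset)
  have contg: "continuous_on {c..q} g" by (rule abs_cont_on_imp_continuous_on[OF g])
  have contg1: "continuous_on {c..d} g" and contg2: "continuous_on {d..q} g"
    using ord by (auto intro: continuous_on_subset[OF contg])
  have split: "integral {c..q} g = integral {c..d} g + integral {d..q} g"
    using Henstock_Kurzweil_Integration.integral_combine[OF ord(2,3), of g] contg by (simp add: integrable_continuous_real)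
  \<comment> \<open>The boundary weights combine through
    \<open>- (1 - d) * f d = d * f d - f d\<close>, and the double integrals other than that of
    \<open>f v * g v\<close> become products of integrals of \<open>f\<close> and \<open>g\<close>.
    With \<open>split\<close> these gather into a multiple of the integral of \<open>g\<close> over
    all of \<open>{c..q}\<close>.\<close>
  have "V11 H a b i j =
      Iint f p c * Ibar g c q + (1 - q) * g q * Iint f c d - c * g c * Ibar f c d
      + integral {c..q} g * (d * f d - c * f c - integral {c..d} f)
      - f d * integral {c..d} g + integral {c..d} (\<lambda>v. f v * g v)"
    unfolding V11_def b f_def[symmetric] g_def[symmetric] p_def[symmetric] c_def[symmetric] split
    using set_lebesgue_integral_continuous[OF contf] product_integral_split[OF contf contg1] product_integral_iterated[OF contf contg2]
      set_lebesgue_integral_continuous[OF contg1] set_lebesgue_integral_continuous[OF contg2]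
      set_lebesgue_integral_continuous[OF continuous_on_mult[OF contf contg1]]
    by (simp add: algebra_simps)
  then show ?thesis
    unfolding sigma2_def pcdq f_def[symmetric] g_def[symmetric]
    using covariance_double_integral[OF f g ord] by simp
qed

end
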